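(* Let $H$ be a transfer Krull monoid over an elementary $2$-group $G$ of (finite) rank $r\ge 2$, i.e. $G\cong C_2^r$. Then $\Delta_{\rho}^*(H)=\Delta_{\rho}(H)=\{1,r-1\}$.
   Context: $C_2^r$ is the direct sum of $r$ copies of the group of order $2$. $\mathbb N$ denotes the positive integers, $\mathbb N_0=\mathbb N\cup\{0\}$. A monoid is an associative semigroup with unit element; $H^{\times}$ is the group of invertible elements of a monoid $H$. $H$ is unit-cancellative if $au=a$ or $ua=a$ (with $a,u\in H$) implies $u\in H^{\times}$. An atom is an element $u\in H\setminus H^{\times}$ such that $u=ab$ with $a,b\in H$ implies $a\in H^\times$ or $b\in H^\times$; $\mathcal A(H)$ is the set of atoms; $H$ is atomic if every non-unit is a finite product of atoms. For $a\in H\setminus H^\times$, $\mathsf L_H(a)=\mathsf L(a)$ is the set of all $k\in\mathbb N$ such that $a$ is a product of $k$ atoms; $\mathsf L(a)=\{0\}$ for $a\in H^\times$; $\mathcal L(H)=\{\mathsf L(a)\mid a\in H\}$. For nonempty $L\subset\mathbb N$ put $\rho(L)=\sup L/\min L$, and $\rho(\{0\})=1$; $\rho(H)=\sup\{\rho(L)\mid L\in\mathcal L(H)\}$. A set $L\subset\mathbb Z$ is an AAP with difference $d\in\mathbb N$ and length $\ell\in\mathbb N_0$ if $L=y+(L'\cup\{0,d,\ldots,\ell d\}\cup L'')\subset y+d\mathbb Z$ for some $y\in\mathbb Z$ and finite sets $L',L''$ with $L'\subset[-M,-1]$ and $L''\subset \ell d+[1,M]$ for some $M\in\mathbb N_0$.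 $\Delta_\rho(H)$ is the set of all $d\in\mathbb N$ such that for every $k\in\mathbb N$ there is some $L_k\in\mathcal L(H)$ which is an AAP with difference $d$, length at least $k$, and $\rho(L_k)=\rho(H)$. For a finite set $L=\{m_1<\ldots<m_k\}\subset\mathbb Z$, $\Delta(L)=\{m_i-m_{i-1}\mid 2\le i\le k\}$. For $S\subset H$, $\Delta_H(S)=\bigcup_{a\in S}\Delta(\mathsf L_H(a))$. For $a\in H$, $[a]=\{a^k\mid k\in\mathbb N_0\}$. Finally $\Delta_\rho^*(H)=\{\min\Delta_H([a])\mid a\in H,\ \rho(\mathsf L(a))=\rho(H)\}$ (where only $a$ with $\Delta_H([a])\ne\emptyset$ contribute; this is automatic if $\rho(H)>1$). For an additive abelian group $G$, $\mathcal F(G)$ is the free abelian monoid with basis $G$ (written multiplicatively, elements $S=g_1\cdots g_\ell$), and $\mathcal B(G)=\{g_1\cdots g_\ell\in\mathcal F(G)\mid g_1+\ldots+g_\ell=0\}$ is the monoid of zero-sum sequences. A monoid homomorphism $\theta\colon H\to B$ between atomic monoids is a weak transfer homomorphism if (T1) $B=B^\times\theta(H)B^\times$ and $\theta^{-1}(B^\times)=H^\times$; (WT2) whenever $a\in H$, $n\in\mathbb N$, $v_1,\ldots,v_n\in\mathcal A(B)$ and $\theta(a)=v_1\cdots v_n$, there are $u_1,\ldots,u_n\in\mathcal A(H)$ and a permutation $\tau$ of $\{1,\ldots,n\}$ with $a=u_1\cdots u_n$ and $\theta(u_i)\in B^\times v_{\tau(i)}B^\times$ for all $i$. A transfer Krull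 monoid over $G$ is an atomic unit-cancellative monoid $H$ admitting a weak transfer homomorphism $\theta\colon H\to\mathcal B(G)$. *)

theory Defs
  imports "HOL-Algebra.Algebra" "HOL-Library.Extended_Real" "HOL-Library.Multiset"
begin

section \<open>Factorizations in (not necessarily commutative) monoids\<close>

definition unit_cancellative :: "('a, 'm) monoid_scheme \<Rightarrow> bool" where
  "unit_cancellative H \<longleftrightarrow>
     (\<forall>a\<in>carrier H. \<forall>u\<in>carrier H.
        a \<otimes>\<^bsub>H\<^esub> u = a \<or> u \<otimes>\<^bsub>H\<^esub> a = a \<longrightarrow> u \<in> Units H)"

text \<open>The library predicate \<^const>\<open>Divisibility.irreducible\<close> is phrased with one-sided
  divisibility and is not the notion of an atom in a noncommutative monoid.\<close>

definition atoms :: "('a, 'm) monoid_scheme \<Rightarrow> 'a set" where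
  "atoms H = {u \<in> carrier H - Units H.
     \<forall>a\<in>carrier H. \<forall>b\<in>carrier H. u = a \<otimes>\<^bsub>H\<^esub> b \<longrightarrow> a \<in> Units H \<or> b \<in> Units H}"

definition list_product :: "('a, 'm) monoid_scheme \<Rightarrow> 'a list \<Rightarrow> 'a" where
  "list_product H us = foldr (\<otimes>\<^bsub>H\<^esub>) us \<one>\<^bsub>H\<^esub>"

definition atomic_monoid :: "('a, 'm) monoid_scheme \<Rightarrow> bool" where
  "atomic_monoid H \<longleftrightarrow>
     monoid H \<and>
     (\<forall>a \<in> carrier H - Units H. \<exists>us. set us \<subseteq> atoms H \<and> list_product H us = a)"

definition length_set :: "('a, 'm) monoid_scheme \<Rightarrow> 'a \<Rightarrow> nat set" where
  "length_set H a =
     (if a \<in> Units H then {0}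
      else {k. k \<ge> 1 \<and>
               (\<exists>us. length us = k \<and> set us \<subseteq> atoms H \<and> list_product H us = a)})"

definition length_sets :: "('a, 'm) monoid_scheme \<Rightarrow> nat set set" where
  "length_sets H = length_set H ` carrier H"

definition set_elasticity :: "nat set \<Rightarrow> ereal" where
  "set_elasticity L =
     (if L = {0} then 1 else (SUP k\<in>L. ereal (real k)) / ereal (real (LEAST k. k \<in> L)))"

definition elasticity :: "('a, 'm) monoid_scheme \<Rightarrow> ereal" where
  "elasticity H = (SUP L\<in>length_sets H. set_elasticity L)"


section \<open>Sets of distances and almost arithmetical progressions\<close>

text \<open>For a finite set \<open>L = {m\<^sub>1 < \<dots> < m\<^sub>k}\<close> these are the differences of consecutive elements;
  the same condition makes sense for infinite \<open>L\<close>.\<close>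

definition distances :: "int set \<Rightarrow> nat set" where
  "distances L = {nat (m' - m) |m m'. m \<in> L \<and> m' \<in> L \<and> m < m' \<and> L \<inter> {m<..<m'} = {}}"

definition distances_in :: "('a, 'm) monoid_scheme \<Rightarrow> 'a set \<Rightarrow> nat set" where
  "distances_in H S = (\<Union>a\<in>S. distances (int ` length_set H a))"

text \<open>\<open>is_AAP L d l\<close>: the set \<open>L\<close> is an almost arithmetical progression with difference \<open>d\<close> and
  length \<open>l\<close>. The bound \<open>M\<close> on the end parts is not a parameter: it may depend on \<open>L\<close>.\<close>

definition is_AAP :: "int set \<Rightarrow> nat \<Rightarrow> nat \<Rightarrow> bool" where
  "is_AAP L d l \<longleftrightarrow>
     d \<ge> 1 \<and>
     (\<exists>(y::int) (M::nat) L' L''.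
        L' \<subseteq> {- int M .. -1} \<and>
        L'' \<subseteq> {int l * int d + 1 .. int l * int d + int M} \<and>
        L = (\<lambda>x. y + x) ` (L' \<union> {int i * int d |i. i \<le> l} \<union> L'') \<and>
        L \<subseteq> {y + int d * z |z. True})"

definition Delta_rho :: "('a, 'm) monoid_scheme \<Rightarrow> nat set" where
  "Delta_rho H =
     {d. d \<ge> 1 \<and>
         (\<forall>k\<ge>1. \<exists>L\<in>length_sets H. \<exists>l\<ge>k.
            is_AAP (int ` L) d l \<and> set_elasticity L = elasticity H)}"

definition powers :: "('a, 'm) monoid_scheme \<Rightarrow> 'a \<Rightarrow> 'a set" where
  "powers H a = {a [^]\<^bsub>H\<^esub> k |k::nat. True}"

text \<open>Elements \<open>a\<close> without any distance in \<open>[a]\<close> have no minimal distance and do not contribute.\<close>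

definition Delta_rho_star :: "('a, 'm) monoid_scheme \<Rightarrow> nat set" where
  "Delta_rho_star H =
     {(LEAST d. d \<in> distances_in H (powers H a)) |a.
        a \<in> carrier H \<and> set_elasticity (length_set H a) = elasticity H \<and>
        distances_in H (powers H a) \<noteq> {}}"


section \<open>Zero-sum sequences and transfer Krull monoids\<close>

text \<open>The free abelian monoid over \<open>G\<close> consists of the finite multisets over \<^term>\<open>carrier G\<close>.
  The abelian group \<open>G\<close> is in multiplicative notation, so the sum of a sequence is its
  \<^const>\<open>list_product\<close> in \<open>G\<close>.\<close>

definition zero_sum_sequences :: "('g, 'm) monoid_scheme \<Rightarrow> 'g multiset monoid" where
  "zero_sum_sequences G =
     \<lparr>carrier = {mset gs |gs. set gs \<subseteq> carrier G \<and> list_product G gs = \<one>\<^bsub>G\<^esub>},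
      monoid.mult = (+), one = {#}\<rparr>"

text \<open>The library's \<^const>\<open>hom\<close> does not include preservation of the unit element.\<close>

definition weak_transfer_hom ::
    "('a, 'm) monoid_scheme \<Rightarrow> ('b, 'n) monoid_scheme \<Rightarrow> ('a \<Rightarrow> 'b) \<Rightarrow> bool" where
  "weak_transfer_hom H B \<theta> \<longleftrightarrow>
     atomic_monoid H \<and> atomic_monoid B \<and>
     \<theta> \<in> hom H B \<and> \<theta> \<one>\<^bsub>H\<^esub> = \<one>\<^bsub>B\<^esub> \<and>
     carrier B = Units B <#>\<^bsub>B\<^esub> (\<theta> ` carrier H) <#>\<^bsub>B\<^esub> Units B \<and>
     {a \<in> carrier H. \<theta> a \<in> Units B} = Units H \<and>
     (\<forall>a\<in>carrier H. \<forall>n\<ge>1. \<forall>vs.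
        length vs = n \<and> set vs \<subseteq> atoms B \<and> \<theta> a = list_product B vs \<longrightarrow>
        (\<exists>us \<tau>. length us = n \<and> set us \<subseteq> atoms H \<and> \<tau> permutes {..<n} \<and>
                a = list_product H us \<and>
                (\<forall>i<n. \<theta> (us ! i) \<in> Units B <#>\<^bsub>B\<^esub> {vs ! (\<tau> i)} <#>\<^bsub>B\<^esub> Units B)))"

definition transfer_Krull :: "('a, 'm) monoid_scheme \<Rightarrow> ('g, 'n) monoid_scheme \<Rightarrow> bool" where
  "transfer_Krull H G \<longleftrightarrow>
     atomic_monoid H \<and> unit_cancellative H \<and>
     (\<exists>\<theta>. weak_transfer_hom H (zero_sum_sequences G) \<theta>)"

definition elementary_2_group :: "nat \<Rightarrow> (nat \<Rightarrow> int) monoid" where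
  "elementary_2_group r = product_group {..<r} (\<lambda>_. integer_mod_group 2)"

end

theory Submission
  imports Defs "HOL-Library.Z2" "HOL-Library.Function_Algebras"
begin

text \<open>
  The monoid \<open>H\<close> enters only through the sets of lengths of its elements and of their powers. A weak transfer
  homomorphism into \<open>\<B>(G)\<close>, whose only unit is the empty sequence, maps atoms to atoms and lifts
  every factorization, so \<open>a\<close> and \<open>\<theta> a\<close> have the same set of lengths (\<open>length_set_eq_lengths\<close>), and
  \<open>\<theta>\<close> is surjective. It remains to study sets of lengths of zero-sum sequences over a group \<open>W\<close> of
  exponent 2 with \<open>2^r\<close> elements.

  The atoms are the squares \<open>g\<^sup>2\<close> with \<open>g \<noteq> 0\<close> and the squarefree sequences supported on circuits of
  the binary matroid \<open>W\<close> (nonempty sets with sum zero and no smaller nonempty zero-sum subset). The proper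
  subsets of a circuit have pairwise different sums, except for complementary pairs, so counting
  shows that a circuit has at most \<open>r + 1\<close> elements and that the subset sums of a circuit with \<open>r + 1\<close>
  elements exhaust \<open>W\<close>. Hence atoms other than \<open>0\<close> have length between \<open>2\<close> and \<open>r + 1\<close>, the
  elasticity is \<open>(r + 1) / 2\<close>, and it is attained exactly by the sequences that are a product of
  squares and also a product of maximal circuits (\<open>extremal\<close>).

  Let \<open>A\<close> be such a sequence. If only one maximal circuit \<open>U\<close> occurs, then \<open>A = U^l\<close> with \<open>l\<close> even, the only
  atoms dividing a power of \<open>A\<close> are \<open>U\<close> and squares, and all lengths are congruent to \<open>l\<close> modulo
  \<open>r - 1\<close>; replacing \<open>U\<^sup>2\<close> by the product of its squares realizes every step \<open>r - 1\<close>.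
  If two different maximal circuits \<open>U\<close> and \<open>V\<close> occur, then the differences of lengths of \<open>A\<close> have
  greatest common divisor 1. Since \<open>A\<close> is a square, any product of circuits in the support of \<open>A\<close> in
  which every element occurs exactly twice or not at all can be exchanged for squares. For a circuit
  \<open>S\<close>, taken twice, a common divisor \<open>d\<close> must divide \<open>|S| - 2\<close>. Write elements of \<open>V\<close> as sums over subsets of \<open>U\<close>;
  a linear functional argument (\<open>crossing_pair\<close>) gives \<open>g, h \<in> V - U\<close> with \<open>g = \<Sum>I\<close>, \<open>h = \<Sum>J\<close> such that
  \<open>I\<close> and \<open>J\<close> cross: all four regions that they cut out of \<open>U\<close> are nonempty. The circuits \<open>{g} \<union> I\<close>,
  \<open>{h} \<union> J\<close> and \<open>{g, h} \<union> (I \<triangle> J)\<close> cover \<open>{g, h} \<union> I \<union> J\<close> twice, so \<open>d\<close> divides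
  \<open>|I \<union> J| - 1\<close>. As \<open>J\<close> may be replaced by \<open>U - J\<close> and \<open>I\<close> by \<open>U - I\<close>, these congruences add up to
  \<open>d\<close> dividing 1 (\<open>length_congruence_trivial\<close>).

  In the second case the differences of two lengths of the same element of \<open>[A]\<close> form a subgroup of the integers,
  which contains 1 because their greatest common divisor is 1; so some power has two consecutive lengths, and its powers have
  arbitrarily long intervals of lengths. So each extremal element contributes \<open>r - 1\<close> or \<open>1\<close>. Both
  values occur: two different maximal circuits exist as soon as \<open>r \<ge> 3\<close>, and for \<open>r = 2\<close> the two values
  are equal.
\<close>

section \<open>Subset sums and circuits in elementary 2-groups\<close>

class boolean_group = ab_group_add +
  assumes add_self [simp]: "x + x = 0"

lemma boolean_add_self_left [simp]: "x + (x + y) = (y::'v::boolean_group)"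
  by (simp flip: add.assoc)

lemma add_eq_0_iff_eq: "x + y = 0 \<longleftrightarrow> x = (y::'v::boolean_group)"
  by (metis boolean_add_self_left add_self add_0_right)

lemma sum_sym_diff:
  fixes S T :: "'v::boolean_group set"
  assumes "finite S" "finite T"
  shows "\<Sum>(sym_diff S T) = \<Sum>S + \<Sum>T"
proof -
  have S: "\<Sum>S = \<Sum>(S - T) + \<Sum>(S \<inter> T)"
    using sum.Int_Diff[OF assms(1), of "\<lambda>x. x" T] by (simp add: add.commute)
  have T: "\<Sum>T = \<Sum>(S \<inter> T) + \<Sum>(T - S)"
    using sum.Int_Diff[OF assms(2), of "\<lambda>x. x" S] by (simp add: Int_commute)
  have "\<Sum>(sym_diff S T) = \<Sum>(S - T) + \<Sum>(T - S)"
    by (rule sum.union_disjoint) (use assms in auto)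
  then show ?thesis
    by (simp add: S T add.assoc)
qed

instance bit :: boolean_group
  by standard simp

instance "fun" :: (type, boolean_group) boolean_group
  by standard (simp add: fun_eq_iff)

text \<open>Over the field with two elements this is linear independence, the coefficients of a linear
  combination being recorded by the subset on which they are 1.\<close>

definition zero_sum_free :: "'v::boolean_group set \<Rightarrow> bool" where
  "zero_sum_free S \<longleftrightarrow> finite S \<and> (\<forall>T\<subseteq>S. \<Sum>T = 0 \<longrightarrow> T = {})"

text \<open>The circuits of the binary matroid. The singleton \<open>{0}\<close> is one of them; it is the atom
  that has to be excluded from sequences of maximal elasticity.\<close>

definition circuit :: "'v::boolean_group set \<Rightarrow> bool" where
  "circuit U \<longleftrightarrow> finite U \<and> U \<noteq> {} \<and> \<Sum>U = 0 \<and> (\<forall>S\<subseteq>U. \<Sum>S = 0 \<longrightarrow> S = {} \<or> S = U)"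

lemma circuitD:
  assumes "circuit U"
  shows "finite U" "U \<noteq> {}" "\<Sum>U = 0"
    and "\<And>S. S \<subseteq> U \<Longrightarrow> \<Sum>S = 0 \<Longrightarrow> S = {} \<or> S = U"
  using assms by (auto simp: circuit_def)

lemma circuit_subset_eq: "circuit U \<Longrightarrow> circuit V \<Longrightarrow> U \<subseteq> V \<Longrightarrow> U = V"
  by (metis circuitD)

text \<open>If two subsets have the same sum, their symmetric difference has sum zero, so it is empty or all
  of \<open>U\<close>. This replaces uniqueness of coordinates: relative to a circuit, coordinates are unique up to
  complement.\<close>

lemma circuit_sum_eq:
  assumes U: "circuit U" and ST: "S \<subseteq> U" "T \<subseteq> U" and eq: "\<Sum>S = \<Sum>T"
  shows "S = T \<or> T = U - S"
proof -
  have fin: "finite S" "finite T"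
    using ST circuitD(1)[OF U] finite_subset by auto
  have "\<Sum>(sym_diff S T) = 0"
    using fin eq by (simp add: sum_sym_diff)
  then have "sym_diff S T = {} \<or> sym_diff S T = U"
    using circuitD(4)[OF U, of "sym_diff S T"] ST by blast
  then show ?thesis
    using ST by blast
qed

lemma circuit_sum_compl:
  assumes U: "circuit U" and S: "S \<subseteq> U"
  shows "\<Sum>(U - S) = \<Sum>S"
proof -
  have "\<Sum>U = \<Sum>(U - S) + \<Sum>S"
    by (rule sum.subset_diff[OF S circuitD(1)[OF U]])
  then show ?thesis
    using circuitD(3)[OF U] by (simp add: add_eq_0_iff_eq)
qed

lemma zero_sum_free_circuit_minus:
  assumes U: "circuit U" and S: "S \<subset> U"
  shows "zero_sum_free S"
  using circuitD[OF U] S unfolding zero_sum_free_def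
  by (metis finite_subset order_trans psubset_imp_subset psubset_eq subset_antisym)

lemma zero_sum_free_inj:
  assumes S: "zero_sum_free S"
  shows "inj_on \<Sum> (Pow S)"
proof (rule inj_onI)
  fix T Z assume TZ: "T \<in> Pow S" "Z \<in> Pow S" and eq: "\<Sum>T = \<Sum>Z"
  have fin: "finite T" "finite Z"
    using S TZ unfolding zero_sum_free_def by (auto intro: finite_subset)
  have "\<Sum>(sym_diff T Z) = 0"
    using fin eq by (simp add: sum_sym_diff)
  moreover have "sym_diff T Z \<subseteq> S"
    using TZ by blast
  ultimately have "sym_diff T Z = {}"
    using S unfolding zero_sum_free_def by blast
  then show "T = Z" by blast
qed

lemma circuit_insert_sum:
  assumes S: "zero_sum_free S" and card: "card S \<ge> 2"
  shows "circuit (insert (\<Sum>S) S)" and "\<Sum>S \<notin> S"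
proof -
  have fin: "finite S" using S by (simp add: zero_sum_free_def)
  show nin: "\<Sum>S \<notin> S"
  proof
    assume "\<Sum>S \<in> S"
    then have "S = {\<Sum>S}"
      using inj_onD[OF zero_sum_free_inj[OF S], of S "{\<Sum>S}"] by simp
    then have "card S = card {\<Sum>S}" by (rule arg_cong)
    then show False using card by simp
  qed
  show "circuit (insert (\<Sum>S) S)"
    unfolding circuit_def
  proof (intro conjI allI impI)
    show "finite (insert (\<Sum>S) S)" "insert (\<Sum>S) S \<noteq> {}" using fin by auto
    show "\<Sum>(insert (\<Sum>S) S) = 0" using fin nin by simp
    fix T assume T: "T \<subseteq> insert (\<Sum>S) S" and Y0: "\<Sum>T = 0"
    show "T = {} \<or> T = insert (\<Sum>S) S"
    proof (cases "\<Sum>S \<in> T")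
      case False
      then have "T \<subseteq> S" using T by auto
      then show ?thesis using S Y0 by (auto simp: zero_sum_free_def)
    next
      case True
      define Z where "Z = T - {\<Sum>S}"
      have Z: "Z \<subseteq> S" "T = insert (\<Sum>S) Z" "\<Sum>S \<notin> Z" using T True by (auto simp: Z_def)
      have "finite Z" using Z fin finite_subset by blast
      then have "\<Sum>S + \<Sum>Z = 0" using Y0 Z by simp
      then have "\<Sum>S = \<Sum>Z" by (simp add: add_eq_0_iff_eq)
      then have "S = Z" using inj_onD[OF zero_sum_free_inj[OF S], of S Z] Z by auto
      then show ?thesis using Z by simp
    qed
  qed
qed

text \<open>A group of order \<open>2^r\<close> and exponent 2. Fixing only its cardinality lets counting of subset sums
  take the place of bases and dimension.\<close>

locale elementary_subgroup =
  fixes W :: "'v::boolean_group set" and r :: nat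
  assumes zero_mem: "0 \<in> W"
    and add_mem: "x \<in> W \<Longrightarrow> y \<in> W \<Longrightarrow> x + y \<in> W"
    and card_W: "card W = 2 ^ r"
    and r_ge_2: "r \<ge> 2"
begin

text \<open>The squarefree atoms whose length is the Davenport constant \<open>r + 1\<close>.\<close>

definition max_circuit :: "'v set \<Rightarrow> bool" where
  "max_circuit U \<longleftrightarrow> circuit U \<and> U \<subseteq> W \<and> card U = r + 1"

lemma finite_W: "finite W"
  using card_W card.infinite by fastforce

lemma sum_mem:
  assumes "S \<subseteq> W" shows "\<Sum>S \<in> W"
proof -
  have "finite S" using assms finite_W finite_subset by blast
  then show ?thesis using assms
    by (induction S) (auto simp: zero_mem add_mem)
qed

lemma zero_sum_free_span_card:
  assumes "zero_sum_free S"
  shows "card (\<Sum> ` Pow S) = 2 ^ card S"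
  using assms by (simp add: card_image zero_sum_free_inj card_Pow zero_sum_free_def)

text \<open>The \<open>2^|S|\<close> subset sums are distinct elements of \<open>W\<close>.\<close>

lemma zero_sum_free_card_le:
  assumes S: "zero_sum_free S" "S \<subseteq> W"
  shows "card S \<le> r"
proof -
  have "\<Sum> ` Pow S \<subseteq> W" using S sum_mem by auto
  then have "2 ^ card S \<le> (2::nat) ^ r"
    using card_mono[OF finite_W] zero_sum_free_span_card[OF S(1)] card_W by metis
  then show ?thesis by simp
qed

lemma zero_sum_free_spans:
  assumes S: "zero_sum_free S" "S \<subseteq> W" "card S = r"
  shows "\<Sum> ` Pow S = W"
proof (rule card_subset_eq[OF finite_W])
  show "\<Sum> ` Pow S \<subseteq> W" using S sum_mem by auto
  show "card (\<Sum> ` Pow S) = card W"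
    using zero_sum_free_span_card[OF S(1)] card_W S by simp
qed

text \<open>Basis extension: as long as \<open>|S| < r\<close>, the subset sums miss some element of \<open>W\<close>, and adding it keeps the
  set independent.\<close>

lemma zero_sum_free_extend:
  assumes S: "zero_sum_free S" "S \<subseteq> W"
  shows "\<exists>T. S \<subseteq> T \<and> T \<subseteq> W \<and> zero_sum_free T \<and> card T = r"
  using assms
proof (induction "r - card S" arbitrary: S)
  case 0
  then show ?case using zero_sum_free_card_le[of S] by (intro exI[of _ S]) auto
next
  case (Suc n)
  have lt: "card S < r" using Suc.hyps by linarith
  have "card (\<Sum> ` Pow S) < card W"
    using zero_sum_free_span_card[OF Suc.prems(1)] card_W lt by simp
  then obtain w where w: "w \<in> W" "w \<notin> \<Sum> ` Pow S"
    by (metis card_mono linorder_not_less subsetI finite_imageI finite_Pow_iff Suc.prems(1) zero_sum_free_def)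
  have fin: "finite S" using Suc.prems by (simp add: zero_sum_free_def)
  have wX: "w \<notin> S"
  proof
    assume "w \<in> S"
    then have "\<Sum>{w} \<in> \<Sum> ` Pow S" by blast
    then show False using w by simp
  qed
  have "zero_sum_free (insert w S)"
    unfolding zero_sum_free_def
  proof (intro conjI allI impI)
    show "finite (insert w S)" using fin by simp
    fix T assume T: "T \<subseteq> insert w S" and Y0: "\<Sum>T = 0"
    show "T = {}"
    proof (cases "w \<in> T")
      case False
      then show ?thesis using T Y0 Suc.prems(1) by (auto simp: zero_sum_free_def)
    next
      case True
      have "finite T" using T fin finite_subset by blast
      then have "w + \<Sum>(T - {w}) = 0"
        using Y0 True by (metis sum.remove)
      then have "w = \<Sum>(T - {w})" by (simp add: add_eq_0_iff_eq)
      then show ?thesis using w T by blast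
    qed
  qed
  moreover have "n = r - card (insert w S)" using Suc.hyps wX fin by simp
  moreover have "insert w S \<subseteq> W" using w Suc.prems by simp
  ultimately obtain T where "insert w S \<subseteq> T" "T \<subseteq> W" "zero_sum_free T" "card T = r"
    using Suc.hyps(1) by blast
  then show ?case by blast
qed

text \<open>A basis together with the sum of its elements is a maximal circuit.\<close>

lemma max_circuit_containing:
  assumes "zero_sum_free S" "S \<subseteq> W"
  shows "\<exists>U. max_circuit U \<and> S \<subseteq> U"
proof -
  obtain T where T: "S \<subseteq> T" "T \<subseteq> W" "zero_sum_free T" "card T = r"
    using zero_sum_free_extend[OF assms] by blast
  have "circuit (insert (\<Sum>T) T)" "\<Sum>T \<notin> T"
    using circuit_insert_sum[OF T(3)] T(4) r_ge_2 by auto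
  then have "max_circuit (insert (\<Sum>T) T)"
    using T sum_mem[OF T(2)] by (simp add: max_circuit_def zero_sum_free_def)
  then show ?thesis using T by blast
qed

lemma max_circuit_exists: "\<exists>U. max_circuit U"
  using max_circuit_containing[of "{}"] by (auto simp: zero_sum_free_def)

lemma circuit_card_le:
  assumes U: "circuit U" "U \<subseteq> W"
  shows "card U \<le> r + 1"
proof -
  obtain u where u: "u \<in> U" using circuitD[OF U(1)] by blast
  have "card (U - {u}) \<le> r"
    using zero_sum_free_card_le[OF zero_sum_free_circuit_minus[OF U(1)], of "U - {u}"] u U by blast
  then show ?thesis using u circuitD(1)[OF U(1)] by simp
qed

lemma max_circuitD:
  assumes "max_circuit U"
  shows "circuit U" "U \<subseteq> W" "card U = r + 1" "finite U" "0 \<notin> U"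
proof -
  show *: "circuit U" "U \<subseteq> W" "card U = r + 1" using assms by (auto simp: max_circuit_def)
  show "finite U" using * by (simp add: circuit_def)
  show "0 \<notin> U"
  proof
    assume "0 \<in> U"
    then have "{0} = U" using circuitD(4)[OF *(1), of "{0}"] by auto
    then have "card U = 1" by auto
    then show False using * r_ge_2 by simp
  qed
qed

lemma max_circuit_spans:
  assumes U: "max_circuit U" and g: "g \<in> W"
  shows "\<exists>I\<subseteq>U. g = \<Sum>I"
proof -
  note U' = max_circuitD[OF U]
  obtain u where u: "u \<in> U" using circuitD[OF U'(1)] by blast
  have "\<Sum> ` Pow (U - {u}) = W"
    using u U' by (intro zero_sum_free_spans zero_sum_free_circuit_minus[OF U'(1)]) auto
  then show ?thesis using g by blast
qed

text \<open>Since \<open>2^r > r + 2\<close>, some nonzero element lies outside \<open>U\<close>; any maximal circuit through it differs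
  from \<open>U\<close>.\<close>

lemma two_max_circuits:
  assumes r: "r \<ge> 3"
  shows "\<exists>U V. max_circuit U \<and> max_circuit V \<and> U \<noteq> V"
proof -
  obtain U where U: "max_circuit U" using max_circuit_exists by blast
  note U' = max_circuitD[OF U]
  have "(2::nat) ^ n > n + 2" if "n \<ge> 3" for n
    using that by (induction n rule: dec_induct) auto
  then have "card (insert 0 U) < card W"
    using U' card_W r by simp
  then obtain w where w: "w \<in> W" "w \<notin> insert 0 U"
    by (metis card_mono linorder_not_less subsetI U'(4) finite_insert)
  have "zero_sum_free {w}"
    using w by (auto simp: zero_sum_free_def subset_singleton_iff)
  then obtain V where V: "max_circuit V" "{w} \<subseteq> V"
    using max_circuit_containing[of "{w}"] w by auto
  then show ?thesis using U w by blast
qed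

end

section \<open>Two maximal circuits contain a crossing pair\<close>

context elementary_subgroup
begin

text \<open>The functional is the sum of the coordinates at \<open>i\<close> and \<open>j\<close> with respect to \<open>U\<close>. A single coordinate is
  not well defined, because complementary subsets of \<open>U\<close> have the same sum, but the sum of two of them is.
  The second property is its additivity.\<close>

lemma separating_functional:
  assumes U: "max_circuit U" and i: "i \<in> U" and j: "j \<in> U"
  obtains \<phi> where "\<And>J. J \<subseteq> U \<Longrightarrow> \<phi> (\<Sum>J) \<longleftrightarrow> (i \<in> J) \<noteq> (j \<in> J)"
    and "\<And>S. S \<subseteq> W \<Longrightarrow> \<phi> (\<Sum>S) \<longleftrightarrow> odd (card {v\<in>S. \<phi> v})"
proof -
  note U' = max_circuitD[OF U]
  define \<phi> where "\<phi> x \<longleftrightarrow> (\<exists>J\<subseteq>U. x = \<Sum>J \<and> (i \<in> J) \<noteq> (j \<in> J))" for x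
  have \<phi>: "\<phi> (\<Sum>J) \<longleftrightarrow> (i \<in> J) \<noteq> (j \<in> J)" if J: "J \<subseteq> U" for J
  proof
    assume "\<phi> (\<Sum>J)"
    then obtain K where K: "K \<subseteq> U" "\<Sum>J = \<Sum>K" "(i \<in> K) \<noteq> (j \<in> K)"
      unfolding \<phi>_def by blast
    then show "(i \<in> J) \<noteq> (j \<in> J)"
      using circuit_sum_eq[OF U'(1) K(1) J] i j by auto
  next
    assume "(i \<in> J) \<noteq> (j \<in> J)"
    then show "\<phi> (\<Sum>J)" unfolding \<phi>_def using J by blast
  qed
  have add: "\<phi> (x + y) \<longleftrightarrow> \<phi> x \<noteq> \<phi> y" if xy: "x \<in> W" "y \<in> W" for x y
  proof -
    obtain I J where IJ: "I \<subseteq> U" "x = \<Sum>I" "J \<subseteq> U" "y = \<Sum>J"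
      using max_circuit_spans[OF U] xy by meson
    have "x + y = \<Sum>(sym_diff I J)"
      using IJ U' finite_subset by (metis sum_sym_diff)
    moreover have "\<phi> (\<Sum>(sym_diff I J)) \<longleftrightarrow> (i \<in> sym_diff I J) \<noteq> (j \<in> sym_diff I J)"
      by (rule \<phi>) (use IJ in blast)
    ultimately show ?thesis
      using \<phi>[of I] \<phi>[of J] IJ by auto
  qed
  have "\<phi> (\<Sum>S) \<longleftrightarrow> odd (card {v\<in>S. \<phi> v})" if S: "S \<subseteq> W" for S
  proof -
    have "finite S" using S finite_W finite_subset by blast
    then show ?thesis using S
    proof (induction S)
      case empty
      then show ?case using \<phi>[of "{}"] by simp
    next
      case (insert x S)
      have *: "{v \<in> insert x S. \<phi> v} = (if \<phi> x then insert x {v\<in>S. \<phi> v} else {v\<in>S. \<phi> v})"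
        by auto
      have "\<phi> (\<Sum>(insert x S)) \<longleftrightarrow> \<phi> x \<noteq> \<phi> (\<Sum>S)"
        using insert add[of x "\<Sum>S"] sum_mem[of S] by simp
      then show ?case
        unfolding * using insert by auto
    qed
  qed
  then show ?thesis using \<phi> that by blast
qed

text \<open>Suppose nothing crosses and let \<open>I\<close> be a smallest subset of \<open>U\<close> representing an element
  of \<open>V - U\<close>. Then no representation of another element of \<open>V - U\<close> separates two points \<open>i, j\<close> of \<open>I\<close>, so
  the functional separating \<open>i\<close> from \<open>j\<close> vanishes on all of \<open>V\<close> except possibly \<open>i\<close> and \<open>j\<close> themselves. As \<open>V\<close> spans,
  one of the two is in \<open>V\<close>; as \<open>V\<close> has sum zero, both are. Hence \<open>I\<close> lies in \<open>V\<close> together with its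
  sum, which forces \<open>V\<close> to be this small circuit and \<open>U - I\<close> to be a single point, against \<open>\<Sum>I \<notin> U\<close>.\<close>

lemma crossing_pair:
  assumes U: "max_circuit U" and V: "max_circuit V" and ne: "U \<noteq> V"
  shows "\<exists>I J. I \<subseteq> U \<and> J \<subseteq> U \<and> \<Sum>I \<in> V - U \<and> \<Sum>J \<in> V - U \<and>
    I \<inter> J \<noteq> {} \<and> I - J \<noteq> {} \<and> J - I \<noteq> {} \<and> U - (I \<union> J) \<noteq> {}"
proof (rule ccontr)
  assume no: "\<not> ?thesis"
  note U' = max_circuitD[OF U] and V' = max_circuitD[OF V]
  have "\<not> V \<subseteq> U"
    using ne U' V' card_subset_eq by metis
  then obtain g0 where g0: "g0 \<in> V - U" by blast
  then obtain I0 where I0: "I0 \<subseteq> U" "g0 = \<Sum>I0"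
    using max_circuit_spans[OF U, of g0] V' by blast
  define P where "P I \<longleftrightarrow> I \<subseteq> U \<and> \<Sum>I \<in> V - U" for I
  have "P I0" using I0 g0 by (simp add: P_def)
  then obtain I where I: "P I" and min: "\<And>J. P J \<Longrightarrow> card I \<le> card J"
    using ex_has_least_nat[of P I0 card] by blast
  have IU: "I \<subseteq> U" and gV: "\<Sum>I \<in> V" "\<Sum>I \<notin> U" using I by (auto simp: P_def)
  have finI: "finite I" using IU U' finite_subset by blast
  have Ine: "I \<noteq> {}" using gV V' by auto
  \<comment> \<open>a set separating two points of \<open>I\<close> without crossing \<open>I\<close> is, up to complement, smaller than \<open>I\<close>\<close>
  have together: "(i \<in> J) = (j \<in> J)" if J: "J \<subseteq> U" "\<Sum>J \<in> V - U" and ij: "i \<in> I" "j \<in> I" for i j J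
  proof (rule ccontr)
    assume sep: "(i \<in> J) \<noteq> (j \<in> J)"
    have PJ: "P J" "P (U - J)"
      using J circuit_sum_compl[OF U'(1) J(1)] by (auto simp: P_def)
    have fin: "finite J" "finite (U - J)" using J U' finite_subset by auto
    have "I \<inter> J \<noteq> {}" "I - J \<noteq> {}" using sep ij by auto
    then have "J - I = {} \<or> U - (I \<union> J) = {}"
      using no J I unfolding P_def by metis
    then have "J \<subset> I \<or> U - J \<subset> I"
      using sep ij IU by blast
    then show False
      using min[OF PJ(1)] min[OF PJ(2)] psubset_card_mono[OF finI, of J] psubset_card_mono[OF finI, of "U - J"]
      by linarith
  qed
  have IV: "I \<subseteq> V"
  proof
    fix i assume i: "i \<in> I"
    have "I \<noteq> {i}" using gV IU by auto
    then obtain j where j: "j \<in> I" "j \<noteq> i" using i by blast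
    obtain \<phi> where \<phi>: "\<And>J. J \<subseteq> U \<Longrightarrow> \<phi> (\<Sum>J) \<longleftrightarrow> (i \<in> J) \<noteq> (j \<in> J)"
      and odd: "\<And>S. S \<subseteq> W \<Longrightarrow> \<phi> (\<Sum>S) \<longleftrightarrow> odd (card {v\<in>S. \<phi> v})"
      using separating_functional[OF U, of i j] i j IU by blast
    have \<phi>_iff: "\<phi> v \<longleftrightarrow> v = i \<or> v = j" if v: "v \<in> V" for v
    proof (cases "v \<in> U")
      case True
      then show ?thesis using \<phi>[of "{v}"] j by auto
    next
      case False
      obtain J where J: "J \<subseteq> U" "v = \<Sum>J"
        using max_circuit_spans[OF U, of v] v V' by blast
      then show ?thesis using \<phi>[of J] together[of J i j] v False i j IU by auto
    qed
    have eq: "{v\<in>S. \<phi> v} = S \<inter> {i, j}" if "S \<subseteq> V" for S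
      using that \<phi>_iff by auto
    have "\<not> \<phi> (\<Sum>V)"
      using circuitD(3)[OF V'(1)] \<phi>[of "{}"] by simp
    then have even: "even (card (V \<inter> {i, j}))"
      using odd[of V] V' eq[of V] by auto
    obtain S where S: "S \<subseteq> V" "i = \<Sum>S"
      using max_circuit_spans[OF V, of i] i IU U' by blast
    have "\<phi> (\<Sum>S)" using \<phi>[of "{i}"] S i j IU by auto
    then have "odd (card (S \<inter> {i, j}))"
      using odd[of S] S V' eq[of S] by auto
    then have "S \<inter> {i, j} \<noteq> {}" by force
    then have "i \<in> V \<or> j \<in> V" using S by blast
    then show "i \<in> V"
      using even j(2) by (cases "j \<in> V"; cases "i \<in> V") auto
  qed
  have gI: "\<Sum>I \<notin> I" using gV IU by blast
  have "insert (\<Sum>I) I = V"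
    using circuitD(4)[OF V'(1), of "insert (\<Sum>I) I"] IV gV finI gI by auto
  then have "card I = r" using gI finI V' by force
  then have "card (U - I) = 1"
    using card_Diff_subset[OF finI IU] U' by simp
  then obtain u where "U - I = {u}" by (meson card_1_singletonE)
  then have "\<Sum>I = u" "u \<in> U"
    using circuit_sum_compl[OF U'(1) IU] by auto
  then show False using gV by simp
qed

end

lemma circuit_insert_sum_subset:
  assumes U: "circuit U" and I: "I \<subset> U" "I \<noteq> {}" and nin: "\<Sum>I \<notin> U"
  shows "circuit (insert (\<Sum>I) I)"
proof -
  have "zero_sum_free I" by (rule zero_sum_free_circuit_minus[OF U I(1)])
  moreover have "card I \<ge> 2"
  proof (rule ccontr)
    assume "\<not> 2 \<le> card I"
    moreover have "card I \<noteq> 0" using I circuitD(1)[OF U] finite_subset by (metis card_0_eq psubset_imp_subset)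
    ultimately have "card I = 1" by linarith
    then obtain u where "I = {u}" by (meson card_1_singletonE)
    then show False using nin I by auto
  qed
  ultimately show ?thesis by (rule circuit_insert_sum)
qed

text \<open>A zero-sum subset containing only one of the two sums would represent \<open>\<Sum>I\<close> or \<open>\<Sum>J\<close> by a subset of the
  symmetric difference; up to complement the only candidates are \<open>I\<close> and \<open>J\<close>, which crossing excludes.\<close>

lemma circuit_insert_two_sums:
  assumes U: "circuit U" and IJ: "I \<subseteq> U" "J \<subseteq> U"
    and crossing: "I \<inter> J \<noteq> {}" "I - J \<noteq> {}" "J - I \<noteq> {}" "U - (I \<union> J) \<noteq> {}"
    and nin: "\<Sum>I \<notin> U" "\<Sum>J \<notin> U"
  shows "circuit ({\<Sum>I, \<Sum>J} \<union> sym_diff I J)" and "\<Sum>I \<noteq> \<Sum>J"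
proof -
  note U' = circuitD[OF U]
  define K where "K = sym_diff I J"
  have KU: "K \<subseteq> U" using IJ by (auto simp: K_def)
  have fin: "finite I" "finite J" "finite K" using IJ KU U'(1) by (auto intro: finite_subset)
  have K: "\<Sum>K = \<Sum>I + \<Sum>J" unfolding K_def by (rule sum_sym_diff) (use fin in auto)
  show ne: "\<Sum>I \<noteq> \<Sum>J"
    using circuit_sum_eq[OF U IJ] crossing by blast
  have only: False if T: "T \<subseteq> K" and "\<Sum>T = \<Sum>I \<or> \<Sum>T = \<Sum>J" for T
    using that circuit_sum_eq[OF U, of T I] circuit_sum_eq[OF U, of T J] IJ KU crossing
    unfolding K_def by blast
  have "circuit ({\<Sum>I, \<Sum>J} \<union> K)"
    unfolding circuit_def
  proof (intro conjI allI impI)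
    show "finite ({\<Sum>I, \<Sum>J} \<union> K)" "{\<Sum>I, \<Sum>J} \<union> K \<noteq> {}" using fin by auto
    have "\<Sum>I \<notin> K" "\<Sum>J \<notin> K" using nin KU by auto
    then show "\<Sum>({\<Sum>I, \<Sum>J} \<union> K) = 0"
      using ne fin K by (simp add: add.left_commute)
    fix S assume S: "S \<subseteq> {\<Sum>I, \<Sum>J} \<union> K" and S0: "\<Sum>S = 0"
    define T where "T = S \<inter> K"
    have TK: "T \<subseteq> K" by (auto simp: T_def)
    have T: "finite T" "\<Sum>I \<notin> T" "\<Sum>J \<notin> T" using fin nin KU by (auto simp: T_def)
    consider "S = T" | "S = insert (\<Sum>I) T" | "S = insert (\<Sum>J) T"
      | "S = insert (\<Sum>I) (insert (\<Sum>J) T)"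
      using S unfolding T_def by blast
    then show "S = {} \<or> S = {\<Sum>I, \<Sum>J} \<union> K"
    proof cases
      case 1
      then have "S = {} \<or> S = U" using U'(4)[of S] TK KU S0 by auto
      then show ?thesis using 1 TK KU crossing unfolding K_def by blast
    next
      case 2
      then have "\<Sum>I + \<Sum>T = 0" using S0 T by simp
      then show ?thesis using only[OF TK] by (simp add: add_eq_0_iff_eq)
    next
      case 3
      then have "\<Sum>J + \<Sum>T = 0" using S0 T by simp
      then show ?thesis using only[OF TK] by (simp add: add_eq_0_iff_eq)
    next
      case 4
      then have "\<Sum>I + (\<Sum>J + \<Sum>T) = 0" using S0 T ne by simp
      then have "\<Sum>T = \<Sum>K" using K by (metis add.assoc add_eq_0_iff_eq)
      then have "K = T" using circuit_sum_eq[OF U, of T K] TK KU crossing unfolding K_def by blast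
      then show ?thesis using 4 by auto
    qed
  qed
  then show "circuit ({\<Sum>I, \<Sum>J} \<union> sym_diff I J)" unfolding K_def .
qed

section \<open>Zero-sum sequences and congruences between factorization lengths\<close>

text \<open>The atoms of the monoid of zero-sum sequences.\<close>

definition minimal_zero_sum :: "'v::boolean_group multiset \<Rightarrow> bool" where
  "minimal_zero_sum M \<longleftrightarrow>
     M \<noteq> {#} \<and> \<Sum>\<^sub># M = 0 \<and> (\<forall>N. N \<subseteq># M \<and> \<Sum>\<^sub># N = 0 \<longrightarrow> N = {#} \<or> N = M)"

text \<open>Factorizations are multisets of atoms, which is possible because the monoid of zero-sum sequences is
  commutative. The empty sequence has the empty factorization, so its set of lengths is \<open>{0}\<close>.\<close>

definition lengths :: "'v::boolean_group multiset \<Rightarrow> nat set" where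
  "lengths A = {size F |F. (\<forall>P\<in>#F. minimal_zero_sum P) \<and> \<Sum>\<^sub># F = A}"

lemma sum_mset_mset_set: "\<Sum>\<^sub># (mset_set S) = \<Sum>S"
  using sum_unfold_sum_mset[of "\<lambda>x. x" S] by simp

lemma minimal_zero_sum_square:
  assumes "g \<noteq> 0"
  shows "minimal_zero_sum {#g, g#}"
  unfolding minimal_zero_sum_def
proof (intro conjI allI impI)
  show "{#g, g#} \<noteq> {#}" "\<Sum>\<^sub># {#g, g#} = 0" by auto
  fix N assume N: "N \<subseteq># {#g, g#} \<and> \<Sum>\<^sub># N = 0"
  then have sub: "N \<subseteq># replicate_mset 2 g" by (simp add: numeral_2_eq_2)
  then obtain n where n: "n \<le> 2" "N = replicate_mset n g"
    by (metis msubseteq_replicate_msetE)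
  then have "n = 0 \<or> n = 1 \<or> n = 2" by auto
  then show "N = {#} \<or> N = {#g, g#}"
    using n N assms by (auto simp: numeral_2_eq_2)
qed

lemma minimal_zero_sum_circuit:
  assumes U: "circuit U"
  shows "minimal_zero_sum (mset_set U)"
  unfolding minimal_zero_sum_def
proof (intro conjI allI impI)
  note U' = circuitD[OF U]
  show "mset_set U \<noteq> {#}" using U' by (simp add: mset_set_empty_iff)
  show "\<Sum>\<^sub># (mset_set U) = 0" using U' by (simp add: sum_mset_mset_set)
  fix N assume N: "N \<subseteq># mset_set U \<and> \<Sum>\<^sub># N = 0"
  have sub: "set_mset N \<subseteq> U" using N set_mset_mono U'(1) by fastforce
  have "N = mset_set (set_mset N)"
  proof (rule multiset_eqI)
    fix x
    have "count N x \<le> 1"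
      using N mset_subset_eq_count[of N "mset_set U" x] by (auto simp: count_mset_set' split: if_splits)
    then show "count N x = count (mset_set (set_mset N)) x"
      by (cases "x \<in># N") (auto simp: count_mset_set' not_in_iff simp flip: count_greater_zero_iff)
  qed
  moreover have "set_mset N = {} \<or> set_mset N = U"
    using U'(4)[OF sub] N calculation sum_mset_mset_set by metis
  ultimately show "N = {#} \<or> N = mset_set U" by auto
qed

text \<open>An element of multiplicity at least 2 already splits off the zero-sum sequence \<open>g\<^sup>2\<close>.\<close>

lemma minimal_zero_sum_cases:
  assumes M: "minimal_zero_sum M"
  obtains g where "g \<noteq> 0" "M = {#g, g#}" | U where "circuit U" "M = mset_set U"
proof (cases "\<exists>g. count M g \<ge> 2")
  case True
  then obtain g where g: "count M g \<ge> 2" by blast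
  have sub: "{#g, g#} \<subseteq># M"
    using g by (auto simp: subseteq_mset_def)
  moreover have "\<Sum>\<^sub># {#g, g#} = 0" by simp
  ultimately have "{#g, g#} = {#} \<or> {#g, g#} = M"
    using M unfolding minimal_zero_sum_def by blast
  then have eq: "M = {#g, g#}" by simp
  have "g \<noteq> 0"
  proof
    assume g0: "g = 0"
    have "\<Sum>\<^sub># {#g#} = 0" using g0 by simp
    moreover have "{#g#} \<subseteq># M" unfolding eq by simp
    ultimately have "{#g#} = {#} \<or> {#g#} = M"
      using M unfolding minimal_zero_sum_def by blast
    then have "size M = 1" by auto
    then show False unfolding eq by simp
  qed
  then show ?thesis using eq that by blast
next
  case False
  define U where "U = set_mset M"
  have M_eq: "M = mset_set U"
  proof (rule multiset_eqI)
    fix x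
    have "count M x < 2" using False not_le by blast
    then show "count M x = count (mset_set U) x"
      unfolding U_def
      by (cases "x \<in># M") (auto simp: count_mset_set' not_in_iff simp flip: count_greater_zero_iff)
  qed
  have fin: "finite U" by (simp add: U_def)
  have "circuit U"
    unfolding circuit_def
  proof (intro conjI allI impI)
    show "finite U" by fact
    show "U \<noteq> {}" "\<Sum>U = 0"
      using M M_eq fin unfolding minimal_zero_sum_def by (auto simp: mset_set_empty_iff sum_mset_mset_set)
    fix S assume S: "S \<subseteq> U" "\<Sum>S = 0"
    have finS: "finite S" using S fin finite_subset by blast
    have "mset_set S \<subseteq># M" using S fin M_eq by (simp add: subset_imp_msubset_mset_set)
    then have "mset_set S = {#} \<or> mset_set S = mset_set U"
      using M S M_eq unfolding minimal_zero_sum_def by (auto simp: sum_mset_mset_set)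
    then show "S = {} \<or> S = U" using fin finS by (auto simp: mset_set_empty_iff)
  qed
  then show ?thesis using M_eq that by blast
qed

lemma lengthsI: "(\<And>P. P \<in># F \<Longrightarrow> minimal_zero_sum P) \<Longrightarrow> \<Sum>\<^sub># F = A \<Longrightarrow> size F \<in> lengths A"
  by (auto simp: lengths_def)

lemma lengthsE:
  assumes "n \<in> lengths A"
  obtains F where "\<And>P. P \<in># F \<Longrightarrow> minimal_zero_sum P" "\<Sum>\<^sub># F = A" "size F = n"
  using assms by (auto simp: lengths_def)

lemma lengths_add:
  assumes "m \<in> lengths A" "n \<in> lengths B"
  shows "m + n \<in> lengths (A + B)"
proof -
  obtain E F where "\<forall>P\<in>#E. minimal_zero_sum P" "\<Sum>\<^sub># E = A" "size E = m"
    "\<forall>P\<in>#F. minimal_zero_sum P" "\<Sum>\<^sub># F = B" "size F = n"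
    using assms by (metis lengthsE)
  then show ?thesis using lengthsI[of "E + F" "A + B"] by auto
qed

lemma zero_in_lengths_iff [simp]: "0 \<in> lengths A \<longleftrightarrow> A = {#}"
  by (auto simp: lengths_def)

lemma lengths_squares:
  assumes "0 \<notin># N"
  shows "size N \<in> lengths (N + N)"
  using assms
proof (induction N)
  case (add g N)
  have "1 \<in> lengths {#g, g#}"
    using lengthsI[of "{#{#g, g#}#}"] minimal_zero_sum_square[of g] add.prems by auto
  then have "1 + size N \<in> lengths ({#g, g#} + (N + N))"
    using add by (intro lengths_add) auto
  then show ?case by (simp add: add_mset_commute)
qed auto

text \<open>The part \<open>Q\<^sup>2\<close> of the square \<open>N\<^sup>2\<close> can be factored by \<open>F\<close> or into \<open>|Q|\<close> squares, while the rest is factored into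
  squares in both cases. The difference of the two lengths is \<open>|F| - |Q|\<close>.\<close>

lemma length_congruence_square_part:
  fixes d :: int
  assumes cong: "\<And>m n. m \<in> lengths (N + N) \<Longrightarrow> n \<in> lengths (N + N) \<Longrightarrow> d dvd int m - int n"
    and N: "0 \<notin># N" and Q: "Q \<subseteq># N"
    and F: "\<And>P. P \<in># F \<Longrightarrow> minimal_zero_sum P" "\<Sum>\<^sub># F = Q + Q"
  shows "d dvd int (size F) - int (size Q)"
proof -
  have "0 \<notin># N - Q" using N by (meson in_diffD)
  then have "size F + size (N - Q) \<in> lengths ((Q + Q) + ((N - Q) + (N - Q)))"
    by (intro lengths_add lengths_squares lengthsI F) auto
  moreover have "(Q + Q) + ((N - Q) + (N - Q)) = N + N"
  proof -
    have "(Q + Q) + ((N - Q) + (N - Q)) = (Q + (N - Q)) + (Q + (N - Q))" by (simp only: ac_simps)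
    then show ?thesis using Q by simp
  qed
  ultimately have "size F + size (N - Q) \<in> lengths (N + N)" by simp
  then have "d dvd int (size F + size (N - Q)) - int (size N)"
    by (rule cong) (rule lengths_squares[OF N])
  moreover have "size (N - Q) = size N - size Q" "size Q \<le> size N"
    using Q by (auto simp: size_Diff_submset size_mset_mono)
  ultimately show ?thesis by (simp add: of_nat_diff algebra_simps)
qed

lemma mset_set_subseteq_iff: "finite S \<Longrightarrow> mset_set S \<subseteq># N \<longleftrightarrow> S \<subseteq> set_mset N"
  by (auto simp: subseteq_mset_def count_mset_set' Suc_le_eq)

lemma length_congruence_circuit:
  fixes d :: int
  assumes cong: "\<And>m n. m \<in> lengths (N + N) \<Longrightarrow> n \<in> lengths (N + N) \<Longrightarrow> d dvd int m - int n"
    and N: "0 \<notin># N" and S: "circuit S" "S \<subseteq> set_mset N"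
  shows "d dvd int (card S) - 2"
proof -
  have "d dvd int (size {#mset_set S, mset_set S#}) - int (size (mset_set S))"
    using circuitD(1)[OF S(1)] S(2) minimal_zero_sum_circuit[OF S(1)]
    by (intro length_congruence_square_part[OF cong N]) (auto simp: mset_set_subseteq_iff)
  then have "d dvd - (int (card S) - 2)" by simp
  then show ?thesis by (simp only: dvd_minus_iff)
qed

text \<open>Points of \<open>I \<inter> J\<close> are covered by the first two sets, points of the symmetric difference by the third and
  one of the others.\<close>

lemma mset_set_crossing_square:
  assumes "finite I" "finite J" "g \<notin> I" "g \<notin> J" "h \<notin> I" "h \<notin> J" "g \<noteq> h"
  shows "mset_set (insert g I) + mset_set (insert h J) + mset_set ({g, h} \<union> sym_diff I J)
    = mset_set ({g, h} \<union> (I \<union> J)) + mset_set ({g, h} \<union> (I \<union> J))"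
proof (rule multiset_eqI)
  fix x
  consider "x = g" | "x = h" | "x \<noteq> g" "x \<noteq> h" by blast
  then show "count (mset_set (insert g I) + mset_set (insert h J) + mset_set ({g, h} \<union> sym_diff I J)) x
    = count (mset_set ({g, h} \<union> (I \<union> J)) + mset_set ({g, h} \<union> (I \<union> J))) x"
    using assms by cases (simp_all add: count_mset_set')
qed

text \<open>Three circuits traded against \<open>|I \<union> J| + 2\<close> squares.\<close>

lemma length_congruence_crossing:
  fixes d :: int
  assumes cong: "\<And>m n. m \<in> lengths (N + N) \<Longrightarrow> n \<in> lengths (N + N) \<Longrightarrow> d dvd int m - int n"
    and N: "0 \<notin># N" and U: "circuit U" "U \<subseteq> set_mset N"
    and IJ: "I \<subseteq> U" "J \<subseteq> U" "\<Sum>I \<in> set_mset N - U" "\<Sum>J \<in> set_mset N - U"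
    and crossing: "I \<inter> J \<noteq> {}" "I - J \<noteq> {}" "J - I \<noteq> {}" "U - (I \<union> J) \<noteq> {}"
  shows "d dvd int (card (I \<union> J)) - 1"
proof -
  let ?g = "\<Sum>I" and ?h = "\<Sum>J"
  have fin: "finite I" "finite J" using IJ circuitD(1)[OF U(1)] by (auto intro: finite_subset)
  have nin: "?g \<notin> I" "?g \<notin> J" "?h \<notin> I" "?h \<notin> J" using IJ by auto
  have g: "circuit (insert ?g I)"
    by (rule circuit_insert_sum_subset[OF U(1)]) (use IJ crossing in auto)
  have h: "circuit (insert ?h J)"
    by (rule circuit_insert_sum_subset[OF U(1)]) (use IJ crossing in auto)
  have gh: "circuit ({?g, ?h} \<union> sym_diff I J)" and ne: "?g \<noteq> ?h"
    using circuit_insert_two_sums[OF U(1) IJ(1,2) crossing] IJ by auto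
  let ?F = "{#mset_set (insert ?g I), mset_set (insert ?h J), mset_set ({?g, ?h} \<union> sym_diff I J)#}"
  let ?Q = "mset_set ({?g, ?h} \<union> (I \<union> J))"
  have "d dvd int (size ?F) - int (size ?Q)"
  proof (rule length_congruence_square_part[OF cong N])
    show "?Q \<subseteq># N" using fin IJ U by (subst mset_set_subseteq_iff) auto
    show "minimal_zero_sum P" if "P \<in># ?F" for P
      using that g h gh by (auto intro: minimal_zero_sum_circuit)
    show "\<Sum>\<^sub># ?F = ?Q + ?Q"
      using mset_set_crossing_square[OF fin nin ne] by (simp add: add.assoc)
  qed
  moreover have "size ?Q = card (I \<union> J) + 2"
    using fin nin ne by simp
  ultimately have "d dvd - (int (card (I \<union> J)) - 1)" by simp
  then show ?thesis by (simp only: dvd_minus_iff)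
qed

context elementary_subgroup
begin

text \<open>With \<open>a = |I|\<close> one has \<open>|I \<union> J| = a + |J - I|\<close>, \<open>|I \<union> (U - J)| = a + |U - (I \<union> J)|\<close> and
  \<open>|U - I| = |J - I| + |U - (I \<union> J)|\<close>. The congruences \<open>|I \<union> J| \<equiv> |I \<union> (U - J)| \<equiv> a \<equiv> |U - I| \<equiv> 1\<close> modulo \<open>d\<close> make
  both summands of \<open>|U - I|\<close> vanish modulo \<open>d\<close>, so \<open>1 \<equiv> 0\<close>.\<close>

lemma length_congruence_trivial:
  fixes d :: int
  assumes cong: "\<And>m n. m \<in> lengths (N + N) \<Longrightarrow> n \<in> lengths (N + N) \<Longrightarrow> d dvd int m - int n"
    and N: "0 \<notin># N" and UV: "max_circuit U" "max_circuit V" "U \<noteq> V"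
    and sub: "U \<subseteq> set_mset N" "V \<subseteq> set_mset N"
  shows "d dvd 1"
proof -
  obtain I J where IJ: "I \<subseteq> U" "J \<subseteq> U" "\<Sum>I \<in> V - U" "\<Sum>J \<in> V - U"
    and crossing: "I \<inter> J \<noteq> {}" "I - J \<noteq> {}" "J - I \<noteq> {}" "U - (I \<union> J) \<noteq> {}"
    using crossing_pair[OF UV] by blast
  note U' = max_circuitD[OF UV(1)]
  have fin: "finite I" "finite J" using IJ U' by (auto intro: finite_subset)
  let ?J = "U - J" and ?I = "U - I"
  have compl: "\<Sum>?J = \<Sum>J" "\<Sum>?I = \<Sum>I"
    using circuit_sum_compl[OF U'(1)] IJ by auto
  have sums: "\<Sum>I \<in> set_mset N - U" "\<Sum>J \<in> set_mset N - U"
      "\<Sum>?I \<in> set_mset N - U" "\<Sum>?J \<in> set_mset N - U"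
    using IJ(3,4) sub(2) unfolding compl by blast+
  have 1: "d dvd int (card (I \<union> J)) - 1"
    by (rule length_congruence_crossing[OF cong N U'(1) sub(1) IJ(1,2) sums(1,2) crossing])
  have crossing': "I \<inter> ?J \<noteq> {}" "I - ?J \<noteq> {}" "?J - I \<noteq> {}" "U - (I \<union> ?J) \<noteq> {}"
    using crossing IJ(1,2) by blast+
  have 2: "d dvd int (card (I \<union> ?J)) - 1"
    by (rule length_congruence_crossing[OF cong N U'(1) sub(1) IJ(1) Diff_subset sums(1,4) crossing'])
  have psub: "I \<subset> U" "I \<noteq> {}" "?I \<subset> U" "?I \<noteq> {}"
    using crossing IJ(1,2) by blast+
  have circuits: "circuit (insert (\<Sum>I) I)" "circuit (insert (\<Sum>?I) ?I)"
    using circuit_insert_sum_subset[OF U'(1) psub(1,2)] circuit_insert_sum_subset[OF U'(1) psub(3,4)] sums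
    by auto
  have subs: "insert (\<Sum>I) I \<subseteq> set_mset N" "insert (\<Sum>?I) ?I \<subseteq> set_mset N"
    using sums sub(1) IJ(1) by blast+
  have "d dvd int (card (insert (\<Sum>I) I)) - 2"
    by (rule length_congruence_circuit[OF cong N circuits(1) subs(1)])
  moreover have "card (insert (\<Sum>I) I) = Suc (card I)"
    by (rule card_insert_disjoint) (use fin sums IJ(1) in blast)+
  ultimately have 3: "d dvd int (card I) - 1" by simp
  have "d dvd int (card (insert (\<Sum>?I) ?I)) - 2"
    by (rule length_congruence_circuit[OF cong N circuits(2) subs(2)])
  moreover have "card (insert (\<Sum>?I) ?I) = Suc (card ?I)"
    by (rule card_insert_disjoint) (use U'(4) sums in blast)+
  ultimately have 4: "d dvd int (card ?I) - 1" by simp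
  have "card (I \<union> J) = card I + card (J - I)"
    using fin by (metis Diff_disjoint Un_Diff_cancel card_Un_disjoint finite_Diff)
  moreover have "card (I \<union> ?J) = card I + card (U - (I \<union> J))"
  proof -
    have "I \<union> ?J = I \<union> (U - (I \<union> J))" using IJ(1,2) by blast
    then show ?thesis using fin U'(4) by (simp add: card_Un_disjoint disjoint_iff)
  qed
  moreover have "card ?I = card (J - I) + card (U - (I \<union> J))"
  proof -
    have "?I = (J - I) \<union> (U - (I \<union> J))" using IJ(1,2) by blast
    then show ?thesis using fin U'(4) by (simp add: card_Un_disjoint disjoint_iff)
  qed
  ultimately have eq: "(int (card (I \<union> J)) - 1) + (int (card (I \<union> ?J)) - 1)
      - 2 * (int (card I) - 1) - (int (card ?I) - 1) = 1" by simp
  have "d dvd (int (card (I \<union> J)) - 1) + (int (card (I \<union> ?J)) - 1)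
      - 2 * (int (card I) - 1) - (int (card ?I) - 1)"
    by (intro dvd_diff dvd_add dvd_mult 1 2 3 4)
  then show ?thesis unfolding eq .
qed

end

section \<open>Sequences of maximal elasticity\<close>

lemma size_sum_mset_ge_eq:
  fixes F :: "'b multiset multiset"
  assumes "\<And>P. P \<in># F \<Longrightarrow> c \<le> size P" and "size (\<Sum>\<^sub># F) = c * size F"
  shows "P \<in># F \<Longrightarrow> size P = c"
proof -
  have ge: "c * size F \<le> size (\<Sum>\<^sub># F)" if "\<And>P. P \<in># F \<Longrightarrow> c \<le> size P" for F :: "'b multiset multiset"
    using that by (induction F) (fastforce simp del: size_mset_sum_mset_conv)+
  assume "P \<in># F"
  then obtain F' where F: "F = add_mset P F'" by (meson mset_add)
  then show "size P = c"
    using assms ge[of F'] by (auto simp del: size_mset_sum_mset_conv simp: order_antisym)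
qed

lemma size_sum_mset_le_eq:
  fixes F :: "'b multiset multiset"
  assumes "\<And>P. P \<in># F \<Longrightarrow> size P \<le> c" and "size (\<Sum>\<^sub># F) = c * size F"
  shows "P \<in># F \<Longrightarrow> size P = c"
proof -
  have ge: "size (\<Sum>\<^sub># F) \<le> c * size F" if "\<And>P. P \<in># F \<Longrightarrow> size P \<le> c" for F :: "'b multiset multiset"
    using that by (induction F) (fastforce simp del: size_mset_sum_mset_conv)+
  assume "P \<in># F"
  then obtain F' where F: "F = add_mset P F'" by (meson mset_add)
  then show "size P = c"
    using assms ge[of F'] by (auto simp del: size_mset_sum_mset_conv simp: order_antisym)
qed

lemma subset_sum_mset: "P \<in># F \<Longrightarrow> P \<subseteq># \<Sum>\<^sub># F"
  by (induction F) (auto intro: subset_mset.order_trans mset_subset_eq_add_right)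

text \<open>Each of the \<open>n\<close> factors \<open>B\<close> is factored in one of two ways, independently.\<close>

lemma lengths_progression:
  assumes "c \<in> lengths B" "c + e \<in> lengths B" "j \<le> n"
  shows "n * c + e * j \<in> lengths (repeat_mset n B)"
  using \<open>j \<le> n\<close>
proof (induction n arbitrary: j)
  case (Suc n)
  show ?case
  proof (cases j)
    case 0
    then show ?thesis using lengths_add[OF assms(1) Suc.IH[of 0]] by simp
  next
    case (Suc i)
    then show ?thesis using lengths_add[OF assms(2) Suc.IH[of i]] Suc.prems
      by (simp add: algebra_simps)
  qed
qed simp

text \<open>The subgroup is generated by its least positive element. The case \<open>d = 0\<close> of the hypothesis excludes
  the zero subgroup.\<close>

lemma int_subgroup_one_mem:
  fixes E :: "int set"
  assumes zero: "0 \<in> E" and diff: "\<And>x y. x \<in> E \<Longrightarrow> y \<in> E \<Longrightarrow> x - y \<in> E"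
    and unit: "\<And>d. (\<And>x. x \<in> E \<Longrightarrow> d dvd x) \<Longrightarrow> d dvd 1"
  shows "1 \<in> E"
proof -
  have neg: "- x \<in> E" if "x \<in> E" for x using diff[OF zero that] by simp
  have add: "x + y \<in> E" if "x \<in> E" "y \<in> E" for x y using diff[OF that(1) neg[OF that(2)]] by simp
  have nat_mult: "int k * x \<in> E" if "x \<in> E" for k x
    by (induction k) (auto simp: zero algebra_simps intro: add that)
  have mult: "z * x \<in> E" if "x \<in> E" for z x
    using nat_mult[OF that, of "nat z"] neg[OF nat_mult[OF that, of "nat (- z)"]]
    by (cases "z \<ge> 0") auto
  have "\<exists>x\<in>E. x \<noteq> 0"
  proof (rule ccontr)
    assume "\<not> ?thesis"
    then have "(0::int) dvd 1" by (intro unit) auto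
    then show False by simp
  qed
  then obtain x where x: "x \<in> E" "x \<noteq> 0" by blast
  have "int (nat \<bar>x\<bar>) \<in> E" "nat \<bar>x\<bar> > 0" using x neg[of x] by (auto simp: abs_if)
  then have "\<exists>n. n > 0 \<and> int n \<in> E" by blast
  then obtain p where p: "p > 0" "int p \<in> E" and least: "\<And>n. n > 0 \<and> int n \<in> E \<Longrightarrow> p \<le> n"
    using exists_least_iff[of "\<lambda>n. n > 0 \<and> int n \<in> E"] by (meson linorder_not_less)
  have "int p dvd x" if "x \<in> E" for x
  proof -
    have "x mod int p = x - (x div int p) * int p" by (simp add: minus_div_mult_eq_mod)
    then have "x mod int p \<in> E" using diff[OF that mult[OF p(2)]] by simp
    moreover have "0 \<le> x mod int p" "x mod int p < int p" using p by auto
    ultimately have "x mod int p = 0"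
      using least[of "nat (x mod int p)"] by (cases "x mod int p = 0") auto
    then show ?thesis by (simp add: dvd_eq_mod_eq_0)
  qed
  then have "int p dvd 1" by (rule unit)
  then show ?thesis using p by simp
qed

text \<open>The differences of lengths have greatest common divisor 1. Allowing \<open>d = 0\<close> makes a
  singleton set of lengths fail the condition.\<close>

definition aperiodic_lengths :: "'v::boolean_group multiset \<Rightarrow> bool" where
  "aperiodic_lengths A \<longleftrightarrow>
     (\<forall>d::int. (\<forall>m\<in>lengths A. \<forall>n\<in>lengths A. d dvd int m - int n) \<longrightarrow> d dvd 1)"

text \<open>Differences of lengths of powers are closed under subtraction, because lengths of \<open>A^k\<close> and \<open>A^k'\<close> add
  up to lengths of \<open>A^(k + k')\<close>.\<close>

lemma consecutive_lengths:
  assumes "aperiodic_lengths A"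
  shows "\<exists>k c. c \<in> lengths (repeat_mset k A) \<and> c + 1 \<in> lengths (repeat_mset k A)"
proof -
  define E where "E = {int m - int n |k m n. m \<in> lengths (repeat_mset k A) \<and> n \<in> lengths (repeat_mset k A)}"
  have EI: "int m - int n \<in> E" if "m \<in> lengths (repeat_mset k A)" "n \<in> lengths (repeat_mset k A)" for k m n
    using that unfolding E_def by blast
  have "1 \<in> E"
  proof (rule int_subgroup_one_mem)
    show "0 \<in> E" using EI[of 0 0 0] by simp
  next
    fix x y assume "x \<in> E" "y \<in> E"
    then obtain k m n k' m' n' where
      x: "x = int m - int n" "m \<in> lengths (repeat_mset k A)" "n \<in> lengths (repeat_mset k A)" and
      y: "y = int m' - int n'" "m' \<in> lengths (repeat_mset k' A)" "n' \<in> lengths (repeat_mset k' A)"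
      unfolding E_def by blast
    have "int (m + n') - int (n + m') \<in> E"
      using EI[of "m + n'" "k + k'" "n + m'"] lengths_add[OF x(2) y(3)] lengths_add[OF x(3) y(2)]
      by (simp add: repeat_mset_distrib)
    moreover have "int (m + n') - int (n + m') = x - y" using x(1) y(1) by simp
    ultimately show "x - y \<in> E" by simp
  next
    fix d assume d: "\<And>x. x \<in> E \<Longrightarrow> d dvd x"
    have "d dvd int m - int n" if "m \<in> lengths A" "n \<in> lengths A" for m n
      using d EI[of m 1 n] that by simp
    then show "d dvd 1" using assms unfolding aperiodic_lengths_def by blast
  qed
  then obtain k m n where "1 = int m - int n" "m \<in> lengths (repeat_mset k A)" "n \<in> lengths (repeat_mset k A)"
    unfolding E_def by blast
  moreover from this have "m = n + 1" by linarith
  ultimately show ?thesis by blast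
qed

context elementary_subgroup
begin

text \<open>The atom \<open>0\<close> of size 1 is the only exception to \<open>2 \<le> |P| \<le> r + 1\<close>; counting zeros separately gives bounds that
  hold for every atom and add up over a factorization.\<close>

lemma atom_size_bounds:
  assumes P: "minimal_zero_sum P" "set_mset P \<subseteq> W"
  shows "2 \<le> size P + count P 0" and "size P + r * count P 0 \<le> r + 1"
    and "size P = 2 \<Longrightarrow> \<exists>g. P = {#g, g#}"
    and "size P = r + 1 \<Longrightarrow> \<exists>U. max_circuit U \<and> P = mset_set U"
proof -
  have "2 \<le> size P + count P 0 \<and> size P + r * count P 0 \<le> r + 1 \<and>
    (size P = 2 \<longrightarrow> (\<exists>g. P = {#g, g#})) \<and>
    (size P = r + 1 \<longrightarrow> (\<exists>U. max_circuit U \<and> P = mset_set U))"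
    using P(1)
  proof (cases rule: minimal_zero_sum_cases)
    case (1 g)
    then show ?thesis using r_ge_2 by auto
  next
    case (2 U)
    note U = circuitD[OF 2(1)]
    have UW: "U \<subseteq> W" using P 2 U(1) by simp
    have le: "card U \<le> r + 1" by (rule circuit_card_le[OF 2(1) UW])
    have max: "max_circuit U" if "card U = r + 1" using that 2 UW by (simp add: max_circuit_def)
    show ?thesis
    proof (cases "0 \<in> U")
      case True
      then have "{0} = U" using U(4)[of "{0}"] by auto
      then show ?thesis using 2 r_ge_2 by auto
    next
      case False
      have "card U \<noteq> 0" using U by simp
      moreover have "card U \<noteq> 1"
      proof
        assume "card U = 1"
        then obtain u where "U = {u}" by (meson card_1_singletonE)
        then show False using U False by simp
      qed
      moreover have "card U \<noteq> 2"
      proof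
        assume "card U = 2"
        then obtain x y where "U = {x, y}" "x \<noteq> y" by (meson card_2_iff)
        then show False using U by (simp add: add_eq_0_iff_eq)
      qed
      ultimately have "card U \<ge> 3" by linarith
      moreover have "card U = r + 1 \<longrightarrow> (\<exists>V. max_circuit V \<and> mset_set U = mset_set V)"
        using max by blast
      ultimately show ?thesis using le 2 False by (simp add: count_mset_set')
    qed
  qed
  then show "2 \<le> size P + count P 0" "size P + r * count P 0 \<le> r + 1"
    "size P = 2 \<Longrightarrow> \<exists>g. P = {#g, g#}"
    "size P = r + 1 \<Longrightarrow> \<exists>U. max_circuit U \<and> P = mset_set U" by auto
qed

lemma factorization_size_bounds:
  assumes "\<And>P. P \<in># F \<Longrightarrow> minimal_zero_sum P" "set_mset (\<Sum>\<^sub># F) \<subseteq> W"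
  shows "2 * size F \<le> size (\<Sum>\<^sub># F) + count (\<Sum>\<^sub># F) 0"
    and "size (\<Sum>\<^sub># F) + r * count (\<Sum>\<^sub># F) 0 \<le> (r + 1) * size F"
proof -
  have "2 * size F \<le> size (\<Sum>\<^sub># F) + count (\<Sum>\<^sub># F) 0 \<and>
    size (\<Sum>\<^sub># F) + r * count (\<Sum>\<^sub># F) 0 \<le> (r + 1) * size F"
    using assms
  proof (induction F)
    case (add P F)
    have "2 * size F \<le> size (\<Sum>\<^sub># F) + count (\<Sum>\<^sub># F) 0 \<and>
      size (\<Sum>\<^sub># F) + r * count (\<Sum>\<^sub># F) 0 \<le> (r + 1) * size F"
      using add.prems by (intro add.IH) auto
    moreover have "2 \<le> size P + count P 0" "size P + r * count P 0 \<le> r + 1"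
      using atom_size_bounds[of P] add.prems by auto
    ultimately show ?case
      by (simp del: size_mset_sum_mset_conv add: algebra_simps)
  qed simp
  then show "2 * size F \<le> size (\<Sum>\<^sub># F) + count (\<Sum>\<^sub># F) 0"
    "size (\<Sum>\<^sub># F) + r * count (\<Sum>\<^sub># F) 0 \<le> (r + 1) * size F" by auto
qed

lemma lengths_ratio_le:
  assumes "m \<in> lengths A" "n \<in> lengths A" "set_mset A \<subseteq> W"
  shows "2 * n \<le> (r + 1) * m"
proof -
  obtain E F where E: "\<And>P. P \<in># E \<Longrightarrow> minimal_zero_sum P" "\<Sum>\<^sub># E = A" "size E = m"
    and F: "\<And>P. P \<in># F \<Longrightarrow> minimal_zero_sum P" "\<Sum>\<^sub># F = A" "size F = n"
    using assms by (metis lengthsE)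
  have "2 * n \<le> size A + count A 0"
    using factorization_size_bounds(1)[of F] F assms by simp
  moreover have "size A + r * count A 0 \<le> (r + 1) * m"
    using factorization_size_bounds(2)[of E] E assms by simp
  moreover have "count A 0 \<le> r * count A 0" using r_ge_2 by simp
  ultimately show ?thesis by linarith
qed

text \<open>The sequences whose set of lengths has the maximal elasticity \<open>(r + 1) / 2\<close>
  (\<open>extremal_set_elasticity\<close>): a longest factorization consists of squares only, and a shortest one of
  maximal circuits only.\<close>

definition extremal :: "'v multiset \<Rightarrow> bool" where
  "extremal A \<longleftrightarrow> A \<noteq> {#} \<and> (\<exists>N. A = N + N) \<and>
     (\<exists>\<U>. (\<forall>U\<in>#\<U>. max_circuit U) \<and> A = \<Sum>\<^sub># (image_mset mset_set \<U>))"

text \<open>Equality in \<open>lengths_ratio_le\<close> forces the absence of \<open>0\<close> (here \<open>r \<ge> 2\<close> enters), and then equality in the size bound for every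
  atom of both factorizations.\<close>

lemma extremalI:
  assumes "m \<in> lengths A" "n \<in> lengths A" "set_mset A \<subseteq> W" "A \<noteq> {#}" and eq: "2 * n = (r + 1) * m"
  shows "extremal A"
proof -
  obtain E F where E: "\<And>P. P \<in># E \<Longrightarrow> minimal_zero_sum P" "\<Sum>\<^sub># E = A" "size E = m"
    and F: "\<And>P. P \<in># F \<Longrightarrow> minimal_zero_sum P" "\<Sum>\<^sub># F = A" "size F = n"
    using assms by (metis lengthsE)
  have up: "2 * n \<le> size A + count A 0"
    using factorization_size_bounds(1)[of F] F assms by simp
  have low: "size A + r * count A 0 \<le> (r + 1) * m"
    using factorization_size_bounds(2)[of E] E assms by simp
  have "r * count A 0 \<le> count A 0" using up low eq by linarith
  moreover have "2 * count A 0 \<le> r * count A 0" using r_ge_2 by simp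
  ultimately have zero: "count A 0 = 0" by linarith
  have size: "size A = 2 * n" "size A = (r + 1) * m" using up low eq zero by auto
  have sub: "P \<subseteq># A" if "P \<in># E \<or> P \<in># F" for P
    using that subset_sum_mset[of P E] subset_sum_mset[of P F] E(2) F(2) by auto
  have sub': "set_mset P \<subseteq> W" "count P 0 = 0" if "P \<in># E \<or> P \<in># F" for P
  proof -
    show "set_mset P \<subseteq> W" using set_mset_mono[OF sub[OF that]] assms(3) by (rule order_trans)
    show "count P 0 = 0" using mset_subset_eq_count[OF sub[OF that], of 0] zero by simp
  qed
  have size_F_eq: "size (\<Sum>\<^sub># F) = 2 * size F"
    unfolding F(2) F(3) by (rule size(1))
  have size_E_eq: "size (\<Sum>\<^sub># E) = (r + 1) * size E"
    unfolding E(2) E(3) by (rule size(2))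
  have size_F: "2 \<le> size P" if "P \<in># F" for P
    using atom_size_bounds(1)[OF F(1)[OF that] sub'(1)] sub'(2)[of P] that by simp
  have "\<exists>g. P = {#g, g#}" if P: "P \<in># F" for P
  proof (rule atom_size_bounds(3)[OF F(1)[OF P] sub'(1)])
    show "size P = 2"
      by (rule size_sum_mset_ge_eq[OF size_F size_F_eq P])
  qed (use P in simp)
  then have "\<exists>N. \<Sum>\<^sub># F = N + N"
  proof (induction F)
    case (add P F)
    have "\<exists>N. \<Sum>\<^sub># F = N + N" by (rule add.IH, rule add.prems) simp
    then obtain N where N: "\<Sum>\<^sub># F = N + N" by blast
    obtain g where "P = {#g, g#}" using add.prems[of P] by auto
    then have "\<Sum>\<^sub># (add_mset P F) = add_mset g N + add_mset g N" using N by simp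
    then show ?case by blast
  qed auto
  then have "\<exists>N. A = N + N" by (simp only: F(2))
  moreover
  have size_E: "size P \<le> r + 1" if "P \<in># E" for P
    using atom_size_bounds(2)[OF E(1)[OF that] sub'(1)] that by simp
  have "\<exists>U. max_circuit U \<and> P = mset_set U" if P: "P \<in># E" for P
  proof (rule atom_size_bounds(4)[OF E(1)[OF P] sub'(1)])
    show "size P = r + 1"
      by (rule size_sum_mset_le_eq[OF size_E size_E_eq P])
  qed (use P in simp)
  then have "\<exists>\<U>. (\<forall>U\<in>#\<U>. max_circuit U) \<and> E = image_mset mset_set \<U>"
  proof (induction E)
    case (add P E)
    have "\<exists>\<U>. (\<forall>U\<in>#\<U>. max_circuit U) \<and> E = image_mset mset_set \<U>"
      by (rule add.IH, rule add.prems) simp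
    then obtain \<U> where "\<forall>U\<in>#\<U>. max_circuit U" "E = image_mset mset_set \<U>" by blast
    moreover obtain U where "max_circuit U" "P = mset_set U" using add.prems[of P] by auto
    ultimately show ?case by (intro exI[of _ "add_mset U \<U>"]) simp
  qed auto
  then have "\<exists>\<U>. (\<forall>U\<in>#\<U>. max_circuit U) \<and> A = \<Sum>\<^sub># (image_mset mset_set \<U>)"
    using E(2) by blast
  ultimately show ?thesis using assms(4) unfolding extremal_def by blast
qed

lemma extremal_subset:
  assumes "extremal A"
  shows "set_mset A \<subseteq> W" "0 \<notin># A"
proof -
  obtain \<U> where \<U>: "\<forall>U\<in>#\<U>. max_circuit U" "A = \<Sum>\<^sub># (image_mset mset_set \<U>)"
    using assms unfolding extremal_def by blast
  have "x \<in> W \<and> x \<noteq> 0" if "x \<in># A" for x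
  proof -
    have "x \<in># \<Sum>\<^sub># (image_mset mset_set \<U>)" using that \<U>(2) by simp
    then obtain U where "U \<in># \<U>" "x \<in># mset_set U"
      by (induction \<U>) auto
    then show ?thesis
      using max_circuitD[of U] \<U>(1) by auto
  qed
  then show "set_mset A \<subseteq> W" "0 \<notin># A" by auto
qed

lemma extremalE:
  assumes "extremal A"
  obtains m n where "m \<ge> 1" "m \<in> lengths A" "n \<in> lengths A" "2 * n = (r + 1) * m"
proof -
  obtain N \<U> where N: "A = N + N" and \<U>: "\<forall>U\<in>#\<U>. max_circuit U" "A = \<Sum>\<^sub># (image_mset mset_set \<U>)"
    and A: "A \<noteq> {#}"
    using assms unfolding extremal_def by blast
  have "size (image_mset mset_set \<U>) \<in> lengths A"
    by (rule lengthsI) (use \<U> max_circuitD(1) minimal_zero_sum_circuit in auto)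
  then have m: "size \<U> \<in> lengths A" by simp
  have n: "size N \<in> lengths A"
    using lengths_squares[of N] extremal_subset(2)[OF assms] unfolding N by simp
  have "size (\<Sum>\<^sub># (image_mset mset_set \<U>)) = (r + 1) * size \<U>"
    using \<U>(1) by (induction \<U>) (auto simp: max_circuit_def)
  then have "2 * size N = (r + 1) * size \<U>" using N \<U>(2) by (metis mult_2 size_union)
  moreover have "size \<U> \<ge> 1" using A \<U>(2) by (cases \<U>) auto
  ultimately show ?thesis using m n that by blast
qed

lemma extremal_add:
  assumes "extremal A" "extremal B"
  shows "extremal (A + B)"
proof -
  obtain M \<U> N \<V> where "A = M + M" "\<forall>U\<in>#\<U>. max_circuit U" "A = \<Sum>\<^sub># (image_mset mset_set \<U>)"
    "B = N + N" "\<forall>U\<in>#\<V>. max_circuit U" "B = \<Sum>\<^sub># (image_mset mset_set \<V>)"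
    using assms unfolding extremal_def by metis
  moreover from this have "A + B = (M + N) + (M + N)" by simp
  ultimately show ?thesis
    using assms unfolding extremal_def
    by (intro conjI exI[of _ "M + N"] exI[of _ "\<U> + \<V>"]) (auto simp: ball_Un)
qed

lemma extremal_repeat:
  assumes "extremal A" "k \<ge> 1"
  shows "extremal (repeat_mset k A)"
  using assms(2) by (induction k rule: dec_induct) (auto intro: extremal_add assms(1))

lemma extremal_square:
  assumes "max_circuit U"
  shows "extremal (repeat_mset 2 (mset_set U))"
  unfolding extremal_def
proof (intro conjI exI)
  show "repeat_mset 2 (mset_set U) \<noteq> {#}"
    using circuitD[OF max_circuitD(1)[OF assms]] by (simp add: repeat_mset_eq_empty_iff mset_set_empty_iff)
  show "repeat_mset 2 (mset_set U) = mset_set U + mset_set U"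
    by (simp add: numeral_2_eq_2)
  show "\<forall>V\<in>#{#U, U#}. max_circuit V" using assms by simp
  show "repeat_mset 2 (mset_set U) = \<Sum>\<^sub># (image_mset mset_set {#U, U#})"
    by (simp add: numeral_2_eq_2)
qed

text \<open>Only squares and \<open>U\<close> divide \<open>U^l\<close>. If \<open>x\<close> copies of \<open>U\<close> are used in a factorization with \<open>n\<close> atoms, comparing sizes gives
  \<open>(r + 1) l = 2 n + (r - 1) x\<close>, and comparing the multiplicity of one element gives \<open>x \<equiv> l\<close> modulo 2.
  Hence \<open>2 (n - l) = (r - 1) (l - x)\<close> with \<open>l - x\<close> even.\<close>

lemma lengths_power_congruence:
  assumes U: "max_circuit U" and n: "n \<in> lengths (repeat_mset l (mset_set U))"
  shows "(int r - 1) dvd int n - int l"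
proof -
  note U' = max_circuitD[OF U]
  obtain F where F: "\<And>P. P \<in># F \<Longrightarrow> minimal_zero_sum P" "\<Sum>\<^sub># F = repeat_mset l (mset_set U)" "size F = n"
    using n by (metis lengthsE)
  obtain g where g: "g \<in> U" using circuitD[OF U'(1)] by blast
  have atoms: "(\<exists>h. P = {#h, h#}) \<or> P = mset_set U" if P: "P \<in># F" for P
  proof -
    have "P \<subseteq># repeat_mset l (mset_set U)"
      using subset_sum_mset[OF P] F(2) by simp
    then have "set_mset P \<subseteq> set_mset (repeat_mset l (mset_set U))" by (rule set_mset_mono)
    also have "\<dots> \<subseteq> set_mset (mset_set U)" by (induction l) auto
    finally have sub: "set_mset P \<subseteq> U" using U'(4) by simp
    from F(1)[OF P] show ?thesis
    proof (cases rule: minimal_zero_sum_cases)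
      case (2 V)
      then have "V \<subseteq> U" using sub circuitD(1) by fastforce
      then show ?thesis using circuit_subset_eq[OF 2(1) U'(1)] 2 by simp
    qed auto
  qed
  have "\<exists>x. int (size (\<Sum>\<^sub># F)) = 2 * int (size F) + (int r - 1) * x \<and> even (int (count (\<Sum>\<^sub># F) g) - x)"
    using atoms
  proof (induction F)
    case (add P F)
    then obtain x where x: "int (size (\<Sum>\<^sub># F)) = 2 * int (size F) + (int r - 1) * x"
      "even (int (count (\<Sum>\<^sub># F) g) - x)" by (metis insert_iff set_mset_add_mset_insert)
    consider h where "P = {#h, h#}" | "P = mset_set U" using add.prems by auto
    then show ?case
    proof cases
      case 1
      then show ?thesis using x
        by (intro exI[of _ x]) (auto simp del: size_mset_sum_mset_conv)
    next
      case 2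
      then show ?thesis using x U' g
        by (intro exI[of _ "x + 1"]) (auto simp del: size_mset_sum_mset_conv simp: algebra_simps count_mset_set')
    qed
  qed auto
  moreover have "int (size (\<Sum>\<^sub># F)) = int l * (int r + 1)" "count (\<Sum>\<^sub># F) g = l"
    unfolding F(2) using U' g by (simp_all add: distrib_left)
  ultimately obtain x where x: "int l * (int r + 1) = 2 * int n + (int r - 1) * x" "even (int l - x)"
    unfolding F(3) by metis
  then obtain y where "int l - x = 2 * y" by blast
  then have "2 * (int n - int l) = 2 * ((int r - 1) * y)"
    using x(1) by (simp add: algebra_simps)
  then have "int n - int l = (int r - 1) * y" by (simp only: mult_cancel_left) simp
  then show ?thesis by simp
qed

lemma extremal_dichotomy:
  assumes A: "extremal A"
  obtains (power) U l where "max_circuit U" "even l" "l \<ge> 1" "A = repeat_mset l (mset_set U)"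
  | (aperiodic) "aperiodic_lengths A"
proof -
  obtain N \<U> where N: "A = N + N" and \<U>: "\<forall>U\<in>#\<U>. max_circuit U" "A = \<Sum>\<^sub># (image_mset mset_set \<U>)"
    and ne: "A \<noteq> {#}"
    using assms unfolding extremal_def by blast
  have "\<U> \<noteq> {#}" using ne \<U>(2) by auto
  then obtain U where U: "U \<in># \<U>" by blast
  note U' = max_circuitD[OF bspec[OF \<U>(1) U]]
  have sub: "V \<subseteq> set_mset N" if "V \<in># \<U>" for V
  proof -
    have "set_mset A = set_mset N" using N by simp
    moreover have "V \<subseteq> set_mset A" using that \<U> max_circuitD(4)[of V] by auto
    ultimately show ?thesis by simp
  qed
  show ?thesis
  proof (cases "\<forall>V\<in>#\<U>. V = U")
    case True
    define l where "l = size \<U>"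
    have "\<Sum>\<^sub># (image_mset mset_set \<U>) = repeat_mset (size \<U>) (mset_set U)"
      using True by (induction \<U>) auto
    then have A_eq: "A = repeat_mset l (mset_set U)" using \<U>(2) unfolding l_def by simp
    obtain g where g: "g \<in> U" using circuitD[OF U'(1)] by blast
    have "count A g = l" unfolding A_eq using g U' by simp
    then have "even l" using N by auto
    moreover have "l \<ge> 1" using ne A_eq by (cases l) auto
    ultimately show ?thesis using power A_eq \<U>(1) U by blast
  next
    case False
    then obtain V where V: "V \<in># \<U>" "V \<noteq> U" by blast
    have "0 \<notin># N" using extremal_subset(2)[OF A] N by simp
    then have "aperiodic_lengths A"
      using length_congruence_trivial[of N _ U V] U V \<U>(1) sub unfolding N aperiodic_lengths_def by blast
    then show ?thesis by (rule aperiodic)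
  qed
qed

lemma aperiodic_extremal_exists:
  assumes "r \<ge> 3"
  shows "\<exists>A. extremal A \<and> aperiodic_lengths A"
proof -
  obtain U V where UV: "max_circuit U" "max_circuit V" "U \<noteq> V" using two_max_circuits[OF assms] by blast
  define A where "A = repeat_mset 2 (mset_set U) + repeat_mset 2 (mset_set V)"
  define N where "N = mset_set U + mset_set V"
  have A: "extremal A" unfolding A_def by (intro extremal_add extremal_square UV)
  have N: "A = N + N" by (simp add: A_def N_def numeral_2_eq_2)
  have "0 \<notin># N" using extremal_subset(2)[OF A] N by simp
  moreover have "U \<subseteq> set_mset N" "V \<subseteq> set_mset N"
    using max_circuitD(4)[OF UV(1)] max_circuitD(4)[OF UV(2)] by (auto simp: N_def)
  ultimately have "aperiodic_lengths A"
    using length_congruence_trivial[of N _ U V] UV unfolding N aperiodic_lengths_def by blast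
  then show ?thesis using A by blast
qed

end

section \<open>Elasticity, progressions and distances\<close>

lemma set_elasticity_eq_Max_Min:
  assumes fin: "finite L" and ne: "L \<noteq> {}" and zero: "0 \<notin> L"
  shows "set_elasticity L = ereal (real (Max L) / real (Min L))"
proof -
  have "(SUP k\<in>L. ereal (real k)) = ereal (real (Max L))"
  proof (rule antisym)
    show "(SUP k\<in>L. ereal (real k)) \<le> ereal (real (Max L))"
      by (rule SUP_least) (simp add: fin)
    show "ereal (real (Max L)) \<le> (SUP k\<in>L. ereal (real k))"
      by (rule SUP_upper) (simp add: fin ne)
  qed
  moreover have "(LEAST k. k \<in> L) = Min L"
    by (rule Least_equality) (simp_all add: fin ne)
  moreover have "Min L \<noteq> 0" using Min_in[OF fin ne] zero by metis
  moreover have "L \<noteq> {0}" using zero by auto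
  ultimately show ?thesis by (simp add: set_elasticity_def)
qed

text \<open>The bound makes \<open>L\<close> finite, so supremum and least element are maximum and minimum, and the
  elasticity is the largest ratio of two elements.\<close>

lemma set_elasticity_bound:
  assumes ne: "L \<noteq> {}" and zero: "0 \<notin> L"
    and bound: "\<And>m n. m \<in> L \<Longrightarrow> n \<in> L \<Longrightarrow> 2 * n \<le> c * m"
  shows "finite L"
    and "set_elasticity L \<le> ereal (real c / 2)"
    and "set_elasticity L = ereal (real c / 2) \<longleftrightarrow> (\<exists>m\<in>L. \<exists>n\<in>L. 2 * n = c * m)"
proof -
  obtain m0 where m0: "m0 \<in> L" using ne by blast
  have "L \<subseteq> {..c * m0}" using bound[OF m0] by fastforce
  then show fin: "finite L" using finite_subset by blast
  have in_L: "Min L \<in> L" "Max L \<in> L" using fin ne by auto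
  have pos: "0 < Min L" using in_L zero by (metis gr0I)
  have le: "2 * real (Max L) \<le> real c * real (Min L)"
    using bound[OF in_L] by (metis of_nat_le_iff of_nat_mult of_nat_numeral)
  note eq = set_elasticity_eq_Max_Min[OF fin ne zero]
  show "set_elasticity L \<le> ereal (real c / 2)"
    unfolding eq using le pos by (simp add: field_simps)
  have "set_elasticity L = ereal (real c / 2) \<longleftrightarrow> 2 * real (Max L) = real c * real (Min L)"
    unfolding eq using pos by (simp add: field_simps)
  also have "\<dots> \<longleftrightarrow> 2 * Max L = c * Min L"
    using of_nat_eq_iff[where 'a = real, of "2 * Max L" "c * Min L"] by simp
  also have "\<dots> \<longleftrightarrow> (\<exists>m\<in>L. \<exists>n\<in>L. 2 * n = c * m)"
  proof
    assume "\<exists>m\<in>L. \<exists>n\<in>L. 2 * n = c * m"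
    then obtain m n where mn: "m \<in> L" "n \<in> L" "2 * n = c * m" by blast
    have "c * Min L \<le> c * m" using fin mn by simp
    also have "\<dots> = 2 * n" using mn by simp
    also have "\<dots> \<le> 2 * Max L" using Max_ge[OF fin mn(2)] by linarith
    finally show "2 * Max L = c * Min L" using bound[OF in_L] by simp
  qed (use in_L in blast)
  finally show "set_elasticity L = ereal (real c / 2) \<longleftrightarrow> (\<exists>m\<in>L. \<exists>n\<in>L. 2 * n = c * m)" .
qed

text \<open>Elements of \<open>L\<close> between \<open>y\<close> and \<open>y + l d\<close> belong to the progression by the congruence; all
  others go into the two end parts, which may be arbitrarily large.\<close>

lemma is_AAP_of_congruent:
  assumes fin: "finite L" and d: "d \<ge> 1"
    and prog: "\<And>i. i \<le> l \<Longrightarrow> y + d * i \<in> L"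
    and cong: "\<And>x. x \<in> L \<Longrightarrow> int d dvd int x - int y"
  shows "is_AAP (int ` L) d l"
proof -
  define K where "K = (\<lambda>x. int x - int y) ` L"
  \<comment> \<open>any common bound on the absolute values works for the end parts\<close>
  define M where "M = nat (\<Sum>x\<in>K. \<bar>x\<bar>)"
  have finK: "finite K" using fin by (simp add: K_def)
  have le_M: "\<bar>x\<bar> \<le> int M" if "x \<in> K" for x
    using member_le_sum[OF that, of abs] finK by (simp add: M_def sum_nonneg)
  have K_eq: "K = {x\<in>K. x < 0} \<union> {int i * int d |i. i \<le> l} \<union> {x\<in>K. x > int l * int d}"
  proof (intro equalityI subsetI)
    fix x assume x: "x \<in> K"
    show "x \<in> {x\<in>K. x < 0} \<union> {int i * int d |i. i \<le> l} \<union> {x\<in>K. x > int l * int d}"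
    proof (cases "x < 0 \<or> x > int l * int d")
      case False
      have "int d dvd x" using x cong by (auto simp: K_def)
      then obtain z where z: "x = int d * z" by blast
      then have "0 \<le> z" "z \<le> int l"
        using False d by (auto simp: mult_less_0_iff mult.commute not_less)
      then have "x = int (nat z) * int d" "nat z \<le> l" using z by auto
      then show ?thesis by blast
    qed (use x in auto)
  next
    fix x assume "x \<in> {x\<in>K. x < 0} \<union> {int i * int d |i. i \<le> l} \<union> {x\<in>K. x > int l * int d}"
    moreover have "int i * int d \<in> K" if "i \<le> l" for i
      unfolding K_def by (rule image_eqI[OF _ prog[OF that]]) simp
    ultimately show "x \<in> K" by auto
  qed
  show ?thesis
    unfolding is_AAP_def
  proof (intro conjI exI)
    show "1 \<le> d" by (rule d)
    show "{x\<in>K. x < 0} \<subseteq> {- int M..-1}" using le_M by fastforce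
    show "{x\<in>K. x > int l * int d} \<subseteq> {int l * int d + 1..int l * int d + int M}"
    proof
      fix x assume x: "x \<in> {x\<in>K. x > int l * int d}"
      then have "x \<le> int M" using le_M[of x] by auto
      also have "\<dots> \<le> int l * int d + int M" by simp
      finally show "x \<in> {int l * int d + 1..int l * int d + int M}" using x by simp
    qed
    show "int ` L = (\<lambda>x. int y + x) ` ({x\<in>K. x < 0} \<union> {int i * int d |i. i \<le> l} \<union> {x\<in>K. x > int l * int d})"
      unfolding K_eq[symmetric] by (simp add: K_def image_image)
    show "int ` L \<subseteq> {int y + int d * z |z. True}"
    proof
      fix x assume "x \<in> int ` L"
      then obtain n where n: "n \<in> L" "x = int n" by blast
      then obtain z where "int n - int y = int d * z" using cong by blast
      then have "x = int y + int d * z" using n by simp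
      then show "x \<in> {int y + int d * z |z. True}" by blast
    qed
  qed
qed

lemma is_AAP_congruent:
  assumes AAP: "is_AAP (int ` L) d l" and l: "l \<ge> 1"
  shows "d \<ge> 1" and "\<And>m n. m \<in> L \<Longrightarrow> n \<in> L \<Longrightarrow> int d dvd int m - int n"
    and "\<exists>m\<in>L. \<exists>n\<in>L. int m - int n = int d"
proof -
  obtain y L' L'' where d: "d \<ge> 1"
    and L: "int ` L = (\<lambda>x. y + x) ` (L' \<union> {int i * int d |i. i \<le> l} \<union> L'')"
    and sub: "int ` L \<subseteq> {y + int d * z |z. True}"
    using AAP unfolding is_AAP_def by (elim conjE exE) (rule that)
  show "d \<ge> 1" by (rule d)
  show "int d dvd int m - int n" if mn: "m \<in> L" "n \<in> L" for m n
  proof -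
    have "int m \<in> {y + int d * z |z. True}" "int n \<in> {y + int d * z |z. True}" using mn sub by blast+
    then obtain z z' where "int m = y + int d * z" "int n = y + int d * z'" by blast
    then have "int m - int n = int d * (z - z')" by (simp add: algebra_simps)
    then show ?thesis by simp
  qed
  have mem: "y + int i * int d \<in> int ` L" if "i \<le> l" for i
    unfolding L using that by blast
  have "y \<in> int ` L" using mem[of 0] by simp
  then obtain n where n: "n \<in> L" "y = int n" by blast
  have "y + int d \<in> int ` L" using mem[of 1] l by simp
  then obtain m where m: "m \<in> L" "y + int d = int m" by blast
  have "int m - int n = int d" using n m by simp
  then show "\<exists>m\<in>L. \<exists>n\<in>L. int m - int n = int d" using m(1) n(1) by blast
qed

lemma distancesE:
  assumes "d \<in> distances (int ` L)"
  obtains m n where "m \<in> L" "n \<in> L" "d \<ge> 1" "int m - int n = int d"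
  using assms unfolding distances_def by fastforce

lemma distancesI:
  assumes mem: "n \<in> L" "n + d \<in> L" and d: "d \<ge> 1"
    and cong: "\<And>m n. m \<in> L \<Longrightarrow> n \<in> L \<Longrightarrow> int d dvd int m - int n"
  shows "d \<in> distances (int ` L)"
proof -
  have "\<not> int m < int n + int d" if m: "m \<in> L" "n < m" for m
  proof -
    have "int d \<le> int m - int n" using m(2) by (intro zdvd_imp_le cong m(1) mem(1)) simp
    then show ?thesis by simp
  qed
  then have "int ` L \<inter> {int n<..<int (n + d)} = {}" by auto
  moreover have "d = nat (int (n + d) - int n)" "int n < int (n + d)" using d by auto
  ultimately show ?thesis using mem unfolding distances_def by blast
qed

lemma lengths_empty: "lengths ({#} :: 'v::boolean_group multiset) = {0}"
proof -
  have "n = 0" if n: "n \<in> lengths ({#} :: 'v multiset)" for n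
  proof -
    obtain F :: "'v multiset multiset"
      where F: "\<forall>P\<in>#F. minimal_zero_sum P" "\<Sum>\<^sub># F = {#}" "size F = n"
      using n unfolding lengths_def by blast
    have False if "P \<in># F" for P
      using subset_sum_mset[OF that] bspec[OF F(1) that] unfolding F(2) minimal_zero_sum_def by simp
    then have "F = {#}" by (meson multiset_nonemptyE)
    then show ?thesis using F(3) by simp
  qed
  moreover have "0 \<in> lengths ({#} :: 'v multiset)" by simp
  ultimately show ?thesis by blast
qed

context elementary_subgroup
begin

lemma lengths_power_progression:
  assumes U: "max_circuit U" and j: "j \<le> k"
  shows "2 * k + (r - 1) * j \<in> lengths (repeat_mset (2 * k) (mset_set U))"
proof -
  note U' = max_circuitD[OF U]
  have sq: "repeat_mset 2 (mset_set U) = mset_set U + mset_set U" by (simp add: numeral_2_eq_2)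
  have "size {#mset_set U, mset_set U#} \<in> lengths (repeat_mset 2 (mset_set U))"
    by (rule lengthsI) (auto simp: sq minimal_zero_sum_circuit[OF U'(1)])
  then have 1: "2 \<in> lengths (repeat_mset 2 (mset_set U))" by (simp add: numeral_2_eq_2)
  have "size (mset_set U) \<in> lengths (repeat_mset 2 (mset_set U))"
    unfolding sq by (rule lengths_squares) (use U' in simp)
  then have 2: "2 + (r - 1) \<in> lengths (repeat_mset 2 (mset_set U))" using U' r_ge_2 by simp
  show ?thesis using lengths_progression[OF 1 2 j] by (simp add: mult.commute)
qed

lemma extremal_sum_zero: "extremal A \<Longrightarrow> \<Sum>\<^sub># A = 0"
  unfolding extremal_def by (metis add_self sum_mset.union)

lemma extremal_set_elasticity:
  assumes A: "set_mset A \<subseteq> W" "lengths A \<noteq> {}"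
  shows "set_elasticity (lengths A) \<le> ereal (real (r + 1) / 2)"
    and "set_elasticity (lengths A) = ereal (real (r + 1) / 2) \<longleftrightarrow> extremal A"
    and "finite (lengths A)"
proof -
  have "set_elasticity (lengths A) \<le> ereal (real (r + 1) / 2) \<and>
    (set_elasticity (lengths A) = ereal (real (r + 1) / 2) \<longleftrightarrow> extremal A) \<and> finite (lengths A)"
  proof (cases "A = {#}")
    case True
    have "lengths A = {0}" unfolding True by (rule lengths_empty)
    then have "set_elasticity (lengths A) = 1" "finite (lengths A)" by (simp_all add: set_elasticity_def)
    moreover have "\<not> extremal A" using True by (simp add: extremal_def)
    moreover have "1 < real (r + 1) / 2" using r_ge_2 by simp
    ultimately show ?thesis by (simp add: one_ereal_def)
  next
    case False
    have zero: "0 \<notin> lengths A" using False by simp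
    note bound = set_elasticity_bound[OF A(2) zero lengths_ratio_le[OF _ _ A(1)]]
    have "(\<exists>m\<in>lengths A. \<exists>n\<in>lengths A. 2 * n = (r + 1) * m) \<longleftrightarrow> extremal A"
      using extremalI[OF _ _ A(1) False] extremalE by metis
    then show ?thesis using bound by simp
  qed
  then show "set_elasticity (lengths A) \<le> ereal (real (r + 1) / 2)"
    "set_elasticity (lengths A) = ereal (real (r + 1) / 2) \<longleftrightarrow> extremal A"
    "finite (lengths A)" by auto
qed

lemma distances_power:
  assumes U: "max_circuit U" and l: "even l" "l \<ge> 1" and A: "A = repeat_mset l (mset_set U)"
  defines "D \<equiv> (\<Union>k. distances (int ` lengths (repeat_mset k A)))"
  shows "r - 1 \<in> D" and "(LEAST d. d \<in> D) = r - 1"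
proof -
  have int_r: "int (r - 1) = int r - 1" using r_ge_2 by simp
  have cong: "int (r - 1) dvd int m - int n"
    if "m \<in> lengths (repeat_mset k A)" "n \<in> lengths (repeat_mset k A)" for m n k
    using lengths_power_congruence[OF U, of m "k * l"] lengths_power_congruence[OF U, of n "k * l"] that
    unfolding A int_r by (metis (no_types, lifting) add_diff_cancel_right' diff_add_cancel diff_diff_eq2 dvd_diff repeat_mset_right)
  obtain h where h: "l = 2 * h" "h \<ge> 1" using l by auto
  have mem: "l \<in> lengths (repeat_mset 1 A)" "l + (r - 1) \<in> lengths (repeat_mset 1 A)"
    using lengths_power_progression[OF U, of 0 h] lengths_power_progression[OF U, of 1 h] h A by auto
  have "r - 1 \<in> distances (int ` lengths (repeat_mset 1 A))"
    by (rule distancesI[OF mem]) (use r_ge_2 cong[of _ 1] in auto)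
  then show D: "r - 1 \<in> D" unfolding D_def by blast
  show "(LEAST d. d \<in> D) = r - 1"
  proof (rule Least_equality, rule D)
    fix d assume "d \<in> D"
    then obtain k where "d \<in> distances (int ` lengths (repeat_mset k A))" unfolding D_def by blast
    then obtain m n where mn: "m \<in> lengths (repeat_mset k A)" "n \<in> lengths (repeat_mset k A)"
      "d \<ge> 1" "int m - int n = int d" by (rule distancesE)
    have "int (r - 1) dvd int d" using cong[OF mn(1,2)] mn(4) by simp
    then show "r - 1 \<le> d" using mn(3) by (auto intro: dvd_imp_le)
  qed
qed

text \<open>Distances are positive, so a pair of consecutive lengths in some power realizes the least possible one.\<close>

lemma distances_aperiodic:
  assumes "aperiodic_lengths A"
  defines "D \<equiv> (\<Union>k. distances (int ` lengths (repeat_mset k A)))"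
  shows "1 \<in> D" and "(LEAST d. d \<in> D) = 1"
proof -
  obtain k c where "c \<in> lengths (repeat_mset k A)" "c + 1 \<in> lengths (repeat_mset k A)"
    using consecutive_lengths[OF assms(1)] by blast
  then have "1 \<in> distances (int ` lengths (repeat_mset k A))" by (intro distancesI) auto
  then show D: "1 \<in> D" unfolding D_def by blast
  show "(LEAST d. d \<in> D) = 1"
  proof (rule Least_equality, rule D)
    fix d assume "d \<in> D"
    then show "1 \<le> d" unfolding D_def by (auto elim!: distancesE)
  qed
qed

lemma AAP_of_power:
  assumes U: "max_circuit U" and fin: "finite (lengths (repeat_mset (2 * k) (mset_set U)))"
  shows "is_AAP (int ` lengths (repeat_mset (2 * k) (mset_set U))) (r - 1) k"
proof (rule is_AAP_of_congruent[OF fin, where y = "2 * k"])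
  show "1 \<le> r - 1" using r_ge_2 by simp
  show "2 * k + (r - 1) * i \<in> lengths (repeat_mset (2 * k) (mset_set U))" if "i \<le> k" for i
    by (rule lengths_power_progression[OF U that])
  show "int (r - 1) dvd int x - int (2 * k)" if "x \<in> lengths (repeat_mset (2 * k) (mset_set U))" for x
    using lengths_power_congruence[OF U that] r_ge_2 by (simp add: of_nat_diff)
qed

lemma AAP_of_aperiodic:
  assumes A: "aperiodic_lengths A" "A \<noteq> {#}" and fin: "\<And>k. finite (lengths (repeat_mset k A))"
  shows "\<exists>k\<ge>1. is_AAP (int ` lengths (repeat_mset k A)) 1 l"
proof -
  obtain k c where kc: "c \<in> lengths (repeat_mset k A)" "c + 1 \<in> lengths (repeat_mset k A)"
    using consecutive_lengths[OF A(1)] by blast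
  have "k \<noteq> 0"
  proof
    assume "k = 0"
    then show False using kc by (simp add: lengths_empty)
  qed
  \<comment> \<open>\<open>Suc l\<close> instead of \<open>l\<close> keeps the exponent positive for \<open>l = 0\<close>\<close>
  have "is_AAP (int ` lengths (repeat_mset (Suc l * k) A)) 1 l"
  proof (rule is_AAP_of_congruent[OF fin, where y = "Suc l * c"])
    show "Suc l * c + 1 * i \<in> lengths (repeat_mset (Suc l * k) A)" if "i \<le> l" for i
      using lengths_progression[OF kc, of i "Suc l"] that by simp
  qed auto
  moreover have "Suc l * k \<ge> 1" using \<open>k \<noteq> 0\<close> by simp
  ultimately show ?thesis by blast
qed

end

section \<open>Transfer from zero-sum sequences to the monoid\<close>

text \<open>Both sets depend only on the sets of lengths of all elements and of their powers, so any map \<open>\<Theta>\<close> onto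
  the zero-sum sequences that preserves these data carries the computation over to \<open>H\<close>.\<close>

lemma (in elementary_subgroup) Delta_rho_of_lengths:
  fixes H :: "('a, 'm) monoid_scheme" and \<Theta> :: "'a \<Rightarrow> 'v multiset"
  assumes lengths: "\<And>a. a \<in> carrier H \<Longrightarrow> length_set H a = lengths (\<Theta> a)"
    and nonempty: "\<And>a. a \<in> carrier H \<Longrightarrow> lengths (\<Theta> a) \<noteq> {}"
    and support: "\<And>a. a \<in> carrier H \<Longrightarrow> set_mset (\<Theta> a) \<subseteq> W"
    and pow_mem: "\<And>a (k::nat). a \<in> carrier H \<Longrightarrow> a [^]\<^bsub>H\<^esub> k \<in> carrier H"
    and pow: "\<And>a (k::nat). a \<in> carrier H \<Longrightarrow> \<Theta> (a [^]\<^bsub>H\<^esub> k) = repeat_mset k (\<Theta> a)"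
    and surj: "\<And>A. set_mset A \<subseteq> W \<Longrightarrow> \<Sum>\<^sub># A = 0 \<Longrightarrow> \<exists>a\<in>carrier H. \<Theta> a = A"
  shows "Delta_rho_star H = {1, r - 1}" and "Delta_rho H = {1, r - 1}"
proof -
  have ex: "\<exists>a\<in>carrier H. \<Theta> a = A" if "extremal A" for A
    using surj extremal_subset(1)[OF that] extremal_sum_zero[OF that] by blast
  have sets: "length_sets H = {lengths (\<Theta> a) |a. a \<in> carrier H}"
    unfolding length_sets_def using lengths by force
  obtain U where U: "max_circuit U" using max_circuit_exists by blast
  have elasticity: "elasticity H = ereal (real (r + 1) / 2)"
    unfolding elasticity_def
  proof (rule antisym)
    show "(SUP L\<in>length_sets H. set_elasticity L) \<le> ereal (real (r + 1) / 2)"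
      by (rule SUP_least) (use extremal_set_elasticity(1)[OF support nonempty] sets in auto)
    obtain a where a: "a \<in> carrier H" "\<Theta> a = repeat_mset 2 (mset_set U)"
      using ex[OF extremal_square[OF U]] by blast
    then have "set_elasticity (lengths (\<Theta> a)) = ereal (real (r + 1) / 2)"
      using extremal_set_elasticity(2)[OF support nonempty, OF a(1) a(1)] extremal_square[OF U] by simp
    moreover have "lengths (\<Theta> a) \<in> length_sets H" using a sets by blast
    ultimately show "ereal (real (r + 1) / 2) \<le> (SUP L\<in>length_sets H. set_elasticity L)"
      by (metis SUP_upper)
  qed
  have extremal_iff: "set_elasticity (length_set H a) = elasticity H \<longleftrightarrow> extremal (\<Theta> a)"
    if "a \<in> carrier H" for a
    unfolding elasticity lengths[OF that] by (rule extremal_set_elasticity(2)[OF support nonempty, OF that that])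
  have finite_pow: "finite (lengths (repeat_mset k (\<Theta> a)))" if "a \<in> carrier H" for a k
    using extremal_set_elasticity(3)[OF support[OF pow_mem[OF that]] nonempty[OF pow_mem[OF that]]] pow[OF that]
    by simp
  have dist: "distances_in H (powers H a) = (\<Union>k. distances (int ` lengths (repeat_mset k (\<Theta> a))))"
    if "a \<in> carrier H" for a
    unfolding distances_in_def powers_def using lengths[OF pow_mem[OF that]] pow[OF that] by auto
  have power_value: "distances_in H (powers H a) \<noteq> {} \<and> (LEAST d. d \<in> distances_in H (powers H a)) = r - 1"
    if "a \<in> carrier H" "max_circuit V" "even l" "l \<ge> 1" "\<Theta> a = repeat_mset l (mset_set V)" for a V l
    using distances_power[OF that(2-5)] unfolding dist[OF that(1)] by blast
  have aperiodic_value: "distances_in H (powers H a) \<noteq> {} \<and> (LEAST d. d \<in> distances_in H (powers H a)) = 1"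
    if "a \<in> carrier H" "aperiodic_lengths (\<Theta> a)" for a
    using distances_aperiodic[OF that(2)] unfolding dist[OF that(1)] by blast
  have r1: "r \<ge> 3" if "r - 1 \<noteq> 1" using that r_ge_2 by simp
  show "Delta_rho_star H = {1, r - 1}"
  proof
    show "Delta_rho_star H \<subseteq> {1, r - 1}"
    proof
      fix d assume "d \<in> Delta_rho_star H"
      then obtain a where a: "a \<in> carrier H" "set_elasticity (length_set H a) = elasticity H"
        and d: "d = (LEAST d. d \<in> distances_in H (powers H a))"
        unfolding Delta_rho_star_def by blast
      have "extremal (\<Theta> a)" using a extremal_iff by simp
      then show "d \<in> {1, r - 1}"
      proof (cases rule: extremal_dichotomy)
        case (power V l)
        then show ?thesis using power_value[OF a(1) power] d by simp
      next
        case aperiodic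
        then show ?thesis using aperiodic_value[OF a(1)] d by simp
      qed
    qed
    have mem: "(LEAST d. d \<in> distances_in H (powers H a)) \<in> Delta_rho_star H"
      if "a \<in> carrier H" "extremal (\<Theta> a)" "distances_in H (powers H a) \<noteq> {}" for a
      using that extremal_iff unfolding Delta_rho_star_def by blast
    obtain a where a: "a \<in> carrier H" "\<Theta> a = repeat_mset 2 (mset_set U)"
      using ex[OF extremal_square[OF U]] by blast
    have r_mem: "r - 1 \<in> Delta_rho_star H"
      using mem[OF a(1)] power_value[OF a(1) U _ _ a(2)] extremal_square[OF U] a(2) by simp
    have "1 \<in> Delta_rho_star H"
    proof (cases "r - 1 = 1")
      case False
      obtain A where A: "extremal A" "aperiodic_lengths A"
        using aperiodic_extremal_exists[OF r1[OF False]] by blast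
      then obtain b where "b \<in> carrier H" "\<Theta> b = A" using ex by blast
      then show ?thesis using mem[of b] aperiodic_value[of b] A by simp
    qed (use r_mem in simp)
    then show "{1, r - 1} \<subseteq> Delta_rho_star H" using r_mem by simp
  qed
  show "Delta_rho H = {1, r - 1}"
  proof
    show "Delta_rho H \<subseteq> {1, r - 1}"
    proof
      fix d assume "d \<in> Delta_rho H"
      then have "\<exists>L\<in>length_sets H. \<exists>l\<ge>1. is_AAP (int ` L) d l \<and> set_elasticity L = elasticity H"
        unfolding Delta_rho_def by blast
      then obtain a l where a: "a \<in> carrier H" "set_elasticity (lengths (\<Theta> a)) = elasticity H"
        and AAP: "is_AAP (int ` lengths (\<Theta> a)) d l" "l \<ge> 1"
        unfolding sets by blast
      note AAP' = is_AAP_congruent[OF AAP]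
      have "extremal (\<Theta> a)" using a extremal_iff lengths by simp
      then show "d \<in> {1, r - 1}"
      proof (cases rule: extremal_dichotomy)
        case (power V k)
        obtain h where h: "k = 2 * h" "h \<ge> 1" using power by auto
        have int_r: "int (r - 1) = int r - 1" using r_ge_2 by simp
        have "int d dvd int (2 * h + (r - 1) * 1) - int (2 * h + (r - 1) * 0)"
          using lengths_power_progression[OF power(1), of _ h] h(2) unfolding power(4) h(1)[symmetric]
          by (intro AAP'(2)[unfolded power(4)]) blast+
        then have "int d dvd int (r - 1)" by simp
        moreover have "int (r - 1) dvd int d"
        proof -
          obtain m n where mn: "m \<in> lengths (\<Theta> a)" "n \<in> lengths (\<Theta> a)" "int m - int n = int d"
            using AAP'(3) by blast
          have "int (r - 1) dvd (int m - int k) - (int n - int k)"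
            unfolding int_r using mn(1,2)
            by (intro dvd_diff[OF lengths_power_congruence[OF power(1)] lengths_power_congruence[OF power(1)]])
              (simp_all only: power(4))
          then show ?thesis using mn(3) by simp
        qed
        ultimately show ?thesis by (simp add: dvd_antisym)
      next
        case aperiodic
        then have "int d dvd 1" using AAP'(2) unfolding aperiodic_lengths_def by blast
        then show ?thesis by simp
      qed
    qed
    have mem: "d \<in> Delta_rho H"
      if d: "d \<ge> 1" and AAP: "\<And>k. k \<ge> 1 \<Longrightarrow> \<exists>A. extremal A \<and> is_AAP (int ` lengths A) d k" for d
      unfolding Delta_rho_def
    proof (intro CollectI conjI allI impI)
      fix k :: nat assume "k \<ge> 1"
      then obtain A where A: "extremal A" "is_AAP (int ` lengths A) d k" using AAP by blast
      then obtain a where a: "a \<in> carrier H" "\<Theta> a = A" using ex by blast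
      have "lengths A \<in> length_sets H" "set_elasticity (lengths A) = elasticity H"
        using a A extremal_iff[OF a(1)] lengths[OF a(1)] sets by auto
      then show "\<exists>L\<in>length_sets H. \<exists>l\<ge>k. is_AAP (int ` L) d l \<and> set_elasticity L = elasticity H"
        using A by blast
    qed (rule d)
    have fin: "finite (lengths A)" if "extremal A" for A
      using ex[OF that] finite_pow[of _ 1] by auto
    have r_mem: "r - 1 \<in> Delta_rho H"
    proof (rule mem)
      show "r - 1 \<ge> 1" using r_ge_2 by simp
      fix k :: nat assume "k \<ge> 1"
      then have "extremal (repeat_mset (2 * k) (mset_set U))"
        using extremal_repeat[OF extremal_square[OF U], of k] by (simp add: mult.commute)
      then show "\<exists>A. extremal A \<and> is_AAP (int ` lengths A) (r - 1) k"
        using AAP_of_power[OF U] fin by blast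
    qed
    have "1 \<in> Delta_rho H"
    proof (cases "r - 1 = 1")
      case False
      obtain A where A: "extremal A" "aperiodic_lengths A"
        using aperiodic_extremal_exists[OF r1[OF False]] by blast
      then have ne: "A \<noteq> {#}" by (simp add: extremal_def)
      have fin': "finite (lengths (repeat_mset k A))" for k
        using ex[OF A(1)] finite_pow by blast
      show ?thesis
      proof (rule mem)
        fix l :: nat
        show "\<exists>B. extremal B \<and> is_AAP (int ` lengths B) 1 l"
          using AAP_of_aperiodic[OF A(2) ne fin', of l] extremal_repeat[OF A(1)] by blast
      qed simp
    qed (use r_mem in simp)
    then show "{1, r - 1} \<subseteq> Delta_rho H" using r_mem by simp
  qed
qed

text \<open>Zero-sum sequences over the multiplicatively written group \<open>G\<close> are transported along \<open>\<phi>\<close> to an additive type, where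
  sums of multisets are available.\<close>

locale boolean_embedding = group G for G :: "('g, 'n) monoid_scheme" +
  fixes \<phi> :: "'g \<Rightarrow> 'v::boolean_group"
  assumes inj: "inj_on \<phi> (carrier G)"
    and mult: "x \<in> carrier G \<Longrightarrow> y \<in> carrier G \<Longrightarrow> \<phi> (x \<otimes>\<^bsub>G\<^esub> y) = \<phi> x + \<phi> y"
begin

abbreviation "B \<equiv> zero_sum_sequences G"

lemma map_one: "\<phi> \<one>\<^bsub>G\<^esub> = 0"
  using mult[of "\<one>\<^bsub>G\<^esub>" "\<one>\<^bsub>G\<^esub>"] by simp

lemma map_list_product:
  "set gs \<subseteq> carrier G \<Longrightarrow> list_product G gs \<in> carrier G \<and> \<phi> (list_product G gs) = sum_list (map \<phi> gs)"
  by (induction gs) (auto simp: list_product_def map_one mult)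

lemma carrier_zero_sum_sequences:
  "carrier B = {M. set_mset M \<subseteq> carrier G \<and> \<Sum>\<^sub># (image_mset \<phi> M) = 0}"
proof -
  have "list_product G gs = \<one>\<^bsub>G\<^esub> \<longleftrightarrow> \<Sum>\<^sub># (image_mset \<phi> (mset gs)) = 0"
    if "set gs \<subseteq> carrier G" for gs
  proof -
    have "list_product G gs = \<one>\<^bsub>G\<^esub> \<longleftrightarrow> \<phi> (list_product G gs) = \<phi> \<one>\<^bsub>G\<^esub>"
      using inj_on_eq_iff[OF inj _ one_closed] map_list_product[OF that] by blast
    then show ?thesis
      using map_list_product[OF that] map_one by (simp flip: mset_map add: sum_mset_sum_list)
  qed
  then have "carrier B = {mset gs |gs. set gs \<subseteq> carrier G \<and> \<Sum>\<^sub># (image_mset \<phi> (mset gs)) = 0}"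
    unfolding zero_sum_sequences_def by auto
  also have "\<dots> = {M. set_mset M \<subseteq> carrier G \<and> \<Sum>\<^sub># (image_mset \<phi> M) = 0}"
    by (auto, metis ex_mset set_mset_mset)
  finally show ?thesis .
qed

lemma B_simps [simp]: "monoid.mult B = (+)" "\<one>\<^bsub>B\<^esub> = {#}"
  by (simp_all add: zero_sum_sequences_def)

lemma Units_zero_sum_sequences: "Units B = {{#}}"
  unfolding Units_def by (auto simp: carrier_zero_sum_sequences)

lemma list_product_zero_sum_sequences: "list_product B vs = \<Sum>\<^sub># (mset vs)"
  by (induction vs) (simp_all add: list_product_def)

lemma atoms_zero_sum_sequences:
  "M \<in> atoms B \<longleftrightarrow> set_mset M \<subseteq> carrier G \<and> minimal_zero_sum (image_mset \<phi> M)"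
proof
  assume M: "M \<in> atoms B"
  then have M': "set_mset M \<subseteq> carrier G" "\<Sum>\<^sub># (image_mset \<phi> M) = 0" "M \<noteq> {#}"
    unfolding atoms_def Units_zero_sum_sequences carrier_zero_sum_sequences by auto
  have split: "P = {#} \<or> Q = {#}" if "P \<in> carrier B" "Q \<in> carrier B" "M = P + Q" for P Q
    using M that unfolding atoms_def Units_zero_sum_sequences by auto
  have "N = {#} \<or> N = image_mset \<phi> M" if N: "N \<subseteq># image_mset \<phi> M" "\<Sum>\<^sub># N = 0" for N
  proof -
    have "image_mset \<phi> M = N + (image_mset \<phi> M - N)" using N(1) by simp
    then obtain P Q where PQ: "M = P + Q" "N = image_mset \<phi> P"
      by (metis image_mset_eq_plusD)
    have "P \<in> carrier B" "Q \<in> carrier B"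
      using M' N(2) PQ by (auto simp: carrier_zero_sum_sequences)
    then have "P = {#} \<or> Q = {#}" using split PQ(1) by blast
    then show ?thesis using PQ by auto
  qed
  then show "set_mset M \<subseteq> carrier G \<and> minimal_zero_sum (image_mset \<phi> M)"
    using M' unfolding minimal_zero_sum_def by simp
next
  assume M: "set_mset M \<subseteq> carrier G \<and> minimal_zero_sum (image_mset \<phi> M)"
  have "P = {#} \<or> Q = {#}" if PQ: "P \<in> carrier B" "Q \<in> carrier B" "M = P + Q" for P Q
  proof -
    have "image_mset \<phi> P \<subseteq># image_mset \<phi> M" "\<Sum>\<^sub># (image_mset \<phi> P) = 0"
      using PQ by (auto simp: carrier_zero_sum_sequences)
    then have "image_mset \<phi> P = {#} \<or> image_mset \<phi> P = image_mset \<phi> M"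
      using M unfolding minimal_zero_sum_def by blast
    then have "P = {#} \<or> size P = size M" by (metis image_mset_is_empty_iff size_image_mset)
    then show ?thesis using PQ(3) by auto
  qed
  then show "M \<in> atoms B"
    using M unfolding atoms_def Units_zero_sum_sequences
    by (auto simp: carrier_zero_sum_sequences minimal_zero_sum_def)
qed

end

locale weak_transfer = boolean_embedding G \<phi> for G :: "('g, 'n) monoid_scheme" and \<phi> :: "'g \<Rightarrow> 'v::boolean_group" +
  fixes H :: "('a, 'm) monoid_scheme" and \<theta> :: "'a \<Rightarrow> 'g multiset"
  assumes \<theta>: "weak_transfer_hom H (zero_sum_sequences G) \<theta>"
begin

definition \<Theta> :: "'a \<Rightarrow> 'v multiset" where
  "\<Theta> a = image_mset \<phi> (\<theta> a)"

lemma atomic: "atomic_monoid H" "monoid H" "atomic_monoid B"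
  using \<theta> by (auto simp: weak_transfer_hom_def atomic_monoid_def)

lemma \<theta>_mem: "a \<in> carrier H \<Longrightarrow> \<theta> a \<in> carrier B"
  using \<theta> by (auto simp: weak_transfer_hom_def hom_def)

lemma \<theta>_mult: "a \<in> carrier H \<Longrightarrow> b \<in> carrier H \<Longrightarrow> \<theta> (a \<otimes>\<^bsub>H\<^esub> b) = \<theta> a + \<theta> b"
  using \<theta> by (auto simp: weak_transfer_hom_def hom_def)

lemma \<theta>_one: "\<theta> \<one>\<^bsub>H\<^esub> = {#}"
  using \<theta> by (auto simp: weak_transfer_hom_def)

lemma \<theta>_unit_iff: "a \<in> carrier H \<Longrightarrow> \<theta> a = {#} \<longleftrightarrow> a \<in> Units H"
  using \<theta> unfolding weak_transfer_hom_def Units_zero_sum_sequences by blast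

lemma \<theta>_surj: "carrier B = \<theta> ` carrier H"
proof -
  have "carrier B = Units B <#>\<^bsub>B\<^esub> (\<theta> ` carrier H) <#>\<^bsub>B\<^esub> Units B"
    using \<theta> unfolding weak_transfer_hom_def by blast
  also have "\<dots> = \<theta> ` carrier H"
    unfolding Units_zero_sum_sequences set_mult_def by auto
  finally show ?thesis .
qed

lemma \<theta>_lift:
  assumes "a \<in> carrier H" "vs \<noteq> []" "set vs \<subseteq> atoms B" "\<theta> a = list_product B vs"
  shows "\<exists>us. length us = length vs \<and> set us \<subseteq> atoms H \<and> a = list_product H us"
proof -
  have "length vs \<ge> 1" using assms(2) by (cases vs) auto
  then show ?thesis
    using \<theta> assms unfolding weak_transfer_hom_def by metis
qed

lemma list_product_mem: "set us \<subseteq> carrier H \<Longrightarrow> list_product H us \<in> carrier H"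
  using atomic(2) by (induction us) (auto simp: list_product_def monoid.m_closed)

lemma \<theta>_list_product: "set us \<subseteq> carrier H \<Longrightarrow> \<theta> (list_product H us) = \<Sum>\<^sub># (mset (map \<theta> us))"
proof (induction us)
  case (Cons u us)
  then show ?case using list_product_mem[of us] by (simp add: list_product_def \<theta>_mult)
qed (simp add: list_product_def \<theta>_one)

lemma atoms_subset: "atoms H \<subseteq> carrier H"
  by (auto simp: atoms_def)

lemma \<theta>_atom_nonempty: "u \<in> atoms H \<Longrightarrow> \<theta> u \<noteq> {#}"
  using \<theta>_unit_iff by (auto simp: atoms_def)

text \<open>Factor \<open>\<theta> u\<close> into atoms and lift to a factorization of the atom \<open>u\<close> of the same length. In \<open>u = w b\<close> the first factor
  is no unit, so \<open>b\<close> is one; a product of atoms that is a unit is empty, because its image is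
  empty. So \<open>\<theta> u\<close> is a single atom.\<close>

lemma \<theta>_atom:
  assumes u: "u \<in> atoms H"
  shows "\<theta> u \<in> atoms B"
proof -
  have uH: "u \<in> carrier H" using u atoms_subset by blast
  have "\<theta> u \<in> carrier B - Units B"
    using \<theta>_mem[OF uH] \<theta>_atom_nonempty[OF u] by (simp add: Units_zero_sum_sequences)
  then obtain vs where vs: "set vs \<subseteq> atoms B" "list_product B vs = \<theta> u"
    using atomic(3) unfolding atomic_monoid_def by blast
  have "vs \<noteq> []" using vs \<theta>_atom_nonempty[OF u] by (auto simp: list_product_zero_sum_sequences)
  then obtain us where us: "length us = length vs" "set us \<subseteq> atoms H" "u = list_product H us"
    using \<theta>_lift[OF uH _ vs(1)] vs(2) by auto
  then obtain w ws where w: "us = w # ws" using \<open>vs \<noteq> []\<close> by (cases us) auto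
  have H: "w \<in> carrier H" "set ws \<subseteq> carrier H" "list_product H ws \<in> carrier H"
    using us w atoms_subset list_product_mem[of ws] by auto
  have "u = w \<otimes>\<^bsub>H\<^esub> list_product H ws" using us w by (simp add: list_product_def)
  then have "w \<in> Units H \<or> list_product H ws \<in> Units H"
    using u H unfolding atoms_def by blast
  moreover have "w \<notin> Units H" using us w by (auto simp: atoms_def)
  ultimately have "\<theta> (list_product H ws) = {#}" using \<theta>_unit_iff H by blast
  then have "\<forall>x\<in>set ws. \<theta> x = {#}" using \<theta>_list_product[OF H(2)] by auto
  moreover have "\<forall>x\<in>set ws. \<theta> x \<noteq> {#}" using us w \<theta>_atom_nonempty by auto
  ultimately have "ws = []" by (cases ws) auto
  then have "length vs = 1" using us w by simp
  then obtain v where "vs = [v]" by (auto simp: length_Suc_conv)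
  then show ?thesis using vs by (simp add: list_product_zero_sum_sequences)
qed

text \<open>Lengths of \<open>a\<close> are lengths of its image because atoms are mapped to atoms; conversely a factorization of
  the image lifts by the defining property of a weak transfer homomorphism.\<close>

lemma length_set_eq_lengths:
  assumes a: "a \<in> carrier H"
  shows "length_set H a = lengths (\<Theta> a)"
proof (cases "a \<in> Units H")
  case True
  then have "\<Theta> a = {#}" using \<theta>_unit_iff[OF a] by (simp add: \<Theta>_def)
  then show ?thesis using True by (simp add: length_set_def lengths_empty)
next
  case False
  then have ne: "\<theta> a \<noteq> {#}" using \<theta>_unit_iff[OF a] by simp
  show ?thesis
  proof (intro equalityI subsetI)
    fix n assume "n \<in> length_set H a"
    then obtain us where us: "length us = n" "set us \<subseteq> atoms H" "list_product H us = a"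
      using False unfolding length_set_def by auto
    have "size (mset (map \<Theta> us)) \<in> lengths (\<Theta> a)"
    proof (rule lengthsI)
      fix P assume "P \<in># mset (map \<Theta> us)"
      then show "minimal_zero_sum P"
        using us(2) \<theta>_atom atoms_zero_sum_sequences by (auto simp: \<Theta>_def)
    next
      have "\<theta> a = \<Sum>\<^sub># (mset (map \<theta> us))" using us \<theta>_list_product atoms_subset by blast
      moreover have "image_mset \<phi> (\<Sum>\<^sub># (mset (map \<theta> us))) = \<Sum>\<^sub># (mset (map \<Theta> us))"
        by (induction us) (simp_all add: \<Theta>_def)
      ultimately show "\<Sum>\<^sub># (mset (map \<Theta> us)) = \<Theta> a" by (simp add: \<Theta>_def)
    qed
    then show "n \<in> lengths (\<Theta> a)" using us(1) by simp
  next
    fix n assume "n \<in> lengths (\<Theta> a)"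
    then obtain F where F: "\<forall>P\<in>#F. minimal_zero_sum P" "\<Sum>\<^sub># F = \<Theta> a" "size F = n"
      unfolding lengths_def by blast
    define \<psi> where "\<psi> = inv_into (carrier G) \<phi>"
    obtain Ps where Ps: "mset Ps = F" using ex_mset by blast
    define vs where "vs = map (image_mset \<psi>) Ps"
    have supp: "set_mset (\<theta> a) \<subseteq> carrier G" using \<theta>_mem[OF a] by (simp add: carrier_zero_sum_sequences)
    have \<psi>: "x \<in> \<phi> ` carrier G \<Longrightarrow> \<psi> x \<in> carrier G \<and> \<phi> (\<psi> x) = x" for x
      unfolding \<psi>_def by (simp add: inv_into_into f_inv_into_f)
    have "set vs \<subseteq> atoms B"
    proof
      fix v assume "v \<in> set vs"
      then obtain P where P: "P \<in># F" "v = image_mset \<psi> P" using Ps by (auto simp: vs_def)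
      have "set_mset P \<subseteq> set_mset (\<Theta> a)" using set_mset_mono[OF subset_sum_mset[OF P(1)]] F(2) by simp
      also have "\<dots> \<subseteq> \<phi> ` carrier G" using supp by (auto simp: \<Theta>_def)
      finally have sub: "set_mset P \<subseteq> \<phi> ` carrier G" .
      then have "image_mset \<phi> v = image_mset (\<lambda>x. x) P"
        unfolding P(2) image_mset.compositionality using \<psi> by (intro image_mset_cong) auto
      moreover have "set_mset v \<subseteq> carrier G" using sub \<psi> P(2) by auto
      ultimately show "v \<in> atoms B" using F(1) P(1) by (simp add: atoms_zero_sum_sequences)
    qed
    moreover have "\<theta> a = list_product B vs"
    proof -
      have "list_product B vs = image_mset \<psi> (\<Sum>\<^sub># (mset Ps))"
        unfolding list_product_zero_sum_sequences vs_def by (induction Ps) simp_all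
      also have "\<dots> = image_mset \<psi> (image_mset \<phi> (\<theta> a))" using Ps F(2) by (simp add: \<Theta>_def)
      also have "\<dots> = image_mset (\<lambda>x. x) (\<theta> a)"
        unfolding image_mset.compositionality \<psi>_def
        using supp inj by (intro image_mset_cong) (auto intro: inv_into_f_f)
      finally show ?thesis by simp
    qed
    moreover have "vs \<noteq> []" using ne calculation(2) by (auto simp: list_product_zero_sum_sequences)
    ultimately obtain us where "length us = length vs" "set us \<subseteq> atoms H" "a = list_product H us"
      using \<theta>_lift[OF a] by blast
    moreover have "length vs = n" using Ps F(3) by (auto simp: vs_def)
    moreover have "n \<ge> 1" using \<open>vs \<noteq> []\<close> \<open>length vs = n\<close> by (cases vs) auto
    ultimately show "n \<in> length_set H a" using False unfolding length_set_def by auto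
  qed
qed

lemma length_set_nonempty:
  assumes a: "a \<in> carrier H"
  shows "length_set H a \<noteq> {}"
proof (cases "a \<in> Units H")
  case False
  then obtain us where us: "set us \<subseteq> atoms H" "list_product H us = a"
    using atomic(1) a unfolding atomic_monoid_def by blast
  have "us \<noteq> []"
  proof
    assume "us = []"
    then have "a = \<one>\<^bsub>H\<^esub>" using us by (simp add: list_product_def)
    then show False using False atomic(2) by (simp add: monoid.Units_one_closed)
  qed
  then have "length us \<ge> 1" by (cases us) auto
  then have "length us \<in> length_set H a" using us False unfolding length_set_def by auto
  then show ?thesis by blast
qed (simp add: length_set_def)

lemma \<Theta>_pow:
  assumes a: "a \<in> carrier H"
  shows "\<Theta> (a [^]\<^bsub>H\<^esub> (k::nat)) = repeat_mset k (\<Theta> a)"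
proof (induction k)
  case (Suc k)
  have "a [^]\<^bsub>H\<^esub> k \<in> carrier H" using atomic(2) a by (rule monoid.nat_pow_closed)
  then show ?case using Suc a by (simp add: \<Theta>_def \<theta>_mult)
qed (simp add: \<Theta>_def \<theta>_one)

lemma \<Theta>_surj:
  assumes A: "set_mset A \<subseteq> \<phi> ` carrier G" "\<Sum>\<^sub># A = 0"
  shows "\<exists>a\<in>carrier H. \<Theta> a = A"
proof -
  define M where "M = image_mset (inv_into (carrier G) \<phi>) A"
  have "image_mset \<phi> M = image_mset (\<lambda>x. x) A"
    unfolding M_def image_mset.compositionality
    using A(1) by (intro image_mset_cong) (auto intro: f_inv_into_f)
  moreover have "set_mset M \<subseteq> carrier G"
    using A(1) by (auto simp: M_def intro: inv_into_into)
  ultimately have "M \<in> carrier B" "image_mset \<phi> M = A"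
    using A(2) by (simp_all add: carrier_zero_sum_sequences)
  then show ?thesis using \<theta>_surj by (auto simp: \<Theta>_def)
qed

end

text \<open>Coordinates are read as bits, with 0 outside \<open>{..<r}\<close> in place of the undefined values of
  the product group, so that group elements become vectors in a single additive type.\<close>

lemma elementary_2_group_boolean_embedding:
  assumes G: "group G" and r: "r \<ge> 2" and iso: "G \<cong> elementary_2_group r"
  obtains \<phi> :: "'g \<Rightarrow> nat \<Rightarrow> bit"
  where "boolean_embedding (G :: ('g, 'n) monoid_scheme) \<phi>" "elementary_subgroup (\<phi> ` carrier G) r"
proof -
  define E where "E = elementary_2_group r"
  define \<kappa> :: "(nat \<Rightarrow> int) \<Rightarrow> nat \<Rightarrow> bit" where "\<kappa> f = (\<lambda>i. if i < r then of_int (f i) else 0)" for f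
  obtain h where h: "h \<in> hom G E" "bij_betw h (carrier G) (carrier E)"
    using iso unfolding is_iso_def iso_def E_def by blast
  have carrier_E: "carrier E = ({..<r} \<rightarrow>\<^sub>E {0..<2})"
    by (simp add: E_def elementary_2_group_def carrier_integer_mod_group)
  have val: "f i = 0 \<or> f i = 1" if "f \<in> carrier E" "i < r" for f i
  proof -
    have "f \<in> {..<r} \<rightarrow>\<^sub>E {0..<2}" using that(1) by (simp only: carrier_E)
    then have "f i \<in> {0..<2}" by (rule PiE_mem) (simp add: that(2))
    then have "0 \<le> f i" "f i < 2" by simp_all
    then show ?thesis by arith
  qed
  have inj_\<kappa>: "inj_on \<kappa> (carrier E)"
  proof (rule inj_onI)
    fix f g assume fg: "f \<in> carrier E" "g \<in> carrier E" and eq: "\<kappa> f = \<kappa> g"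
    show "f = g"
    proof
      fix i
      show "f i = g i"
      proof (cases "i < r")
        case True
        then have "(of_int (f i) :: bit) = of_int (g i)" using fun_cong[OF eq, of i] by (simp add: \<kappa>_def)
        then show ?thesis using val[OF fg(1) True] val[OF fg(2) True] by auto
      next
        case False
        then have "i \<notin> {..<r}" by simp
        then show ?thesis
          using PiE_arb[OF fg(1)[unfolded carrier_E]] PiE_arb[OF fg(2)[unfolded carrier_E]] by simp
      qed
    qed
  qed
  have mult_\<kappa>: "\<kappa> (f \<otimes>\<^bsub>E\<^esub> g) = \<kappa> f + \<kappa> g" if fg: "f \<in> carrier E" "g \<in> carrier E" for f g
  proof
    fix i
    show "\<kappa> (f \<otimes>\<^bsub>E\<^esub> g) i = (\<kappa> f + \<kappa> g) i"
      using val[OF fg(1), of i] val[OF fg(2), of i]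
      by (cases "i < r") (auto simp: \<kappa>_def E_def elementary_2_group_def)
  qed
  define \<phi> where "\<phi> = \<kappa> \<circ> h"
  have h_mem: "h x \<in> carrier E" if "x \<in> carrier G" for x using h(2) that by (auto simp: bij_betw_def)
  have mult: "\<phi> (x \<otimes>\<^bsub>G\<^esub> y) = \<phi> x + \<phi> y" if "x \<in> carrier G" "y \<in> carrier G" for x y
    using that h(1) mult_\<kappa>[OF h_mem h_mem] by (simp add: \<phi>_def hom_mult)
  have inj: "inj_on \<phi> (carrier G)"
    unfolding \<phi>_def using h(2) inj_\<kappa> by (auto simp: bij_betw_def intro: comp_inj_on)
  interpret group G by (rule G)
  interpret boolean_embedding G \<phi>
    by unfold_locales (rule inj, rule mult)
  have "card (carrier G) = card (carrier E)" using h(2) by (rule bij_betw_same_card)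
  also have "\<dots> = 2 ^ r" unfolding carrier_E by (simp add: card_PiE)
  finally have "card (\<phi> ` carrier G) = 2 ^ r" using card_image[OF inj] by simp
  moreover have "0 \<in> \<phi> ` carrier G" using map_one by (metis imageI one_closed)
  moreover have "x + y \<in> \<phi> ` carrier G" if "x \<in> \<phi> ` carrier G" "y \<in> \<phi> ` carrier G" for x y
    using that mult by (metis (no_types, lifting) image_iff m_closed)
  ultimately have "elementary_subgroup (\<phi> ` carrier G) r"
    using r by unfold_locales auto
  then show ?thesis using that boolean_embedding_axioms by blast
qed

theorem theorem3p13:
  fixes H :: "('a, 'm) monoid_scheme" and G :: "('g, 'n) monoid_scheme" and r :: nat
  assumes "comm_group G"
    and "r \<ge> 2"
    and "G \<cong> elementary_2_group r"
    and "transfer_Krull H G"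
  shows "Delta_rho_star H = Delta_rho H \<and> Delta_rho H = {1, r - 1}"
proof -
  have "group G" using assms(1) by (rule comm_group.axioms(2))
  then obtain \<phi> :: "'g \<Rightarrow> nat \<Rightarrow> bit"
    where \<phi>: "boolean_embedding G \<phi>" "elementary_subgroup (\<phi> ` carrier G) r"
    using elementary_2_group_boolean_embedding[OF _ assms(2,3)] by blast
  obtain \<theta> where \<theta>: "weak_transfer_hom H (zero_sum_sequences G) \<theta>"
    using assms(4) unfolding transfer_Krull_def by blast
  interpret boolean_embedding G \<phi> by (rule \<phi>(1))
  interpret weak_transfer G \<phi> H \<theta> by unfold_locales (rule \<theta>)
  interpret elementary_subgroup "\<phi> ` carrier G" r by (rule \<phi>(2))
  have "set_mset (\<Theta> a) \<subseteq> \<phi> ` carrier G" if "a \<in> carrier H" for a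
    using \<theta>_mem[OF that] by (auto simp: \<Theta>_def carrier_zero_sum_sequences)
  moreover have "lengths (\<Theta> a) \<noteq> {}" if "a \<in> carrier H" for a
    using length_set_nonempty[OF that] length_set_eq_lengths[OF that] by simp
  ultimately have "Delta_rho_star H = {1, r - 1}" "Delta_rho H = {1, r - 1}"
    by (intro Delta_rho_of_lengths[of H \<Theta>] length_set_eq_lengths \<Theta>_pow \<Theta>_surj
        monoid.nat_pow_closed[OF atomic(2)]; simp)+
  then show ?thesis by simp
qed

end
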